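(* Let $p$ be an odd prime and let $n\geq 2$ be an integer. Let $L/K$ be a separable field extension of degree $p^n$. If $L/K$ has a Hopf Galois structure of type $C_{p^n}$, then $L/K$ has no Hopf Galois structure of noncyclic type; that is, it has no Hopf Galois structure whose type is a noncyclic group of order $p^n$.
   Context: $C_m$ denotes the cyclic group of order $m$. A Hopf Galois structure on a finite field extension $L/K$ is a pair $(\mathcal{H},\mu)$, where $\mathcal{H}$ is a finite cocommutative $K$-Hopf algebra and $\mu:\mathcal{H}\to \operatorname{End}_K(L)$ is a $K$-linear map giving $L$ a left $\mathcal{H}$-module algebra structure and inducing a $K$-vector space isomorphism $L\otimes_K \mathcal{H}\to \operatorname{End}_K(L)$. Let $L/K$ be finite separable of degree $g$ with normal closure $\widetilde{L}$, $G=\operatorname{Gal}(\widetilde{L}/K)$, $G'=\operatorname{Gal}(\widetilde{L}/L)$, and let $\lambda:G\hookrightarrow \operatorname{Sym}(G/G')\cong S_g$ be the action of $G$ on the left cosets $G/G'$. By the theorem of Greither and Pareigis, isomorphism classes of Hopf Galois structures on $L/K$ are in bijection with regular subgroups $N$ of $\operatorname{Sym}(G/G')$ normalized by $\lambda(G)$ (the Hopf algebra corresponding to $N$ is $\widetilde{L}[N]^G$, with $G$ acting on $\widetilde{L}$ by automorphisms and on $N$ by conjugation through $\lambda$). The type of a Hopf Galois structure is the isomorphism class of the corresponding group $N$. *)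

theory Defs
  imports
    "HOL-Algebra.Algebra"
    "HOL-Algebra.Finite_Extensions"
    "HOL-Algebra.Free_Abelian_Groups"
    "HOL-Algebra.Elementary_Groups"
    "HOL-Algebra.Bij"
    "HOL-Algebra.Left_Coset"
    "HOL-Computational_Algebra.Primes"
begin

section \<open>Modules and tensor products\<close>

definition linear_maps ::
  "('r, 'x) ring_scheme \<Rightarrow> ('r, 'v, 'y) module_scheme \<Rightarrow> ('r, 'w, 'z) module_scheme \<Rightarrow> ('v \<Rightarrow> 'w) set"
  where "linear_maps R V W =
    {f \<in> carrier V \<rightarrow> carrier W.
       (\<forall>u \<in> carrier V. \<forall>v \<in> carrier V. f (u \<oplus>\<^bsub>V\<^esub> v) = f u \<oplus>\<^bsub>W\<^esub> f v) \<and>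
       (\<forall>r \<in> carrier R. \<forall>v \<in> carrier V. f (r \<odot>\<^bsub>V\<^esub> v) = r \<odot>\<^bsub>W\<^esub> f v)}"

definition linear_isos ::
  "('r, 'x) ring_scheme \<Rightarrow> ('r, 'v, 'y) module_scheme \<Rightarrow> ('r, 'w, 'z) module_scheme \<Rightarrow> ('v \<Rightarrow> 'w) set"
  where "linear_isos R V W = {f \<in> linear_maps R V W. bij_betw f (carrier V) (carrier W)}"

definition regular_module :: "('r, 'x) ring_scheme \<Rightarrow> ('r, 'r) module"
  where "regular_module R =
    \<lparr>carrier = carrier R, monoid.mult = monoid.mult R, monoid.one = monoid.one R,
     ring.zero = ring.zero R, ring.add = ring.add R, smult = monoid.mult R\<rparr>"

definition End_algebra ::
  "('r, 'x) ring_scheme \<Rightarrow> ('r, 'v, 'y) module_scheme \<Rightarrow> ('r, 'v \<Rightarrow> 'v) module"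
  where "End_algebra R V =
    \<lparr>carrier = linear_maps R V V \<inter> extensional (carrier V),
     monoid.mult = compose (carrier V),
     monoid.one = (\<lambda>v \<in> carrier V. v),
     ring.zero = (\<lambda>v \<in> carrier V. \<zero>\<^bsub>V\<^esub>),
     ring.add = (\<lambda>f g. \<lambda>v \<in> carrier V. f v \<oplus>\<^bsub>V\<^esub> g v),
     smult = (\<lambda>r f. \<lambda>v \<in> carrier V. r \<odot>\<^bsub>V\<^esub> f v)\<rparr>"

text \<open>
  The tensor product of two \<open>R\<close>-modules is the free abelian group on
  \<open>carrier V \<times> carrier W\<close> modulo the subgroup generated by the usual bilinearity relations;
  its elements are cosets of that subgroup.
\<close>

type_synonym ('v, 'w) tensor = "('v \<times> 'w \<Rightarrow>\<^sub>0 int) set"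

definition tensor_relations ::
  "('r, 'x) ring_scheme \<Rightarrow> ('r, 'v, 'y) module_scheme \<Rightarrow> ('r, 'w, 'z) module_scheme
    \<Rightarrow> ('v \<times> 'w \<Rightarrow>\<^sub>0 int) set"
  where "tensor_relations R V W =
    generate (free_Abelian_group (carrier V \<times> carrier W))
     ({frag_of (u \<oplus>\<^bsub>V\<^esub> v, w) - (frag_of (u, w) + frag_of (v, w)) | u v w.
         u \<in> carrier V \<and> v \<in> carrier V \<and> w \<in> carrier W} \<union>
      {frag_of (v, w \<oplus>\<^bsub>W\<^esub> x) - (frag_of (v, w) + frag_of (v, x)) | v w x.
         v \<in> carrier V \<and> w \<in> carrier W \<and> x \<in> carrier W} \<union>
      {frag_of (r \<odot>\<^bsub>V\<^esub> v, w) - frag_of (v, r \<odot>\<^bsub>W\<^esub> w) | r v w.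
         r \<in> carrier R \<and> v \<in> carrier V \<and> w \<in> carrier W})"

definition tensor_group ::
  "('r, 'x) ring_scheme \<Rightarrow> ('r, 'v, 'y) module_scheme \<Rightarrow> ('r, 'w, 'z) module_scheme
    \<Rightarrow> ('v, 'w) tensor monoid"
  where "tensor_group R V W =
    free_Abelian_group (carrier V \<times> carrier W) Mod tensor_relations R V W"

definition pure_tensor ::
  "('r, 'x) ring_scheme \<Rightarrow> ('r, 'v, 'y) module_scheme \<Rightarrow> ('r, 'w, 'z) module_scheme
    \<Rightarrow> 'v \<Rightarrow> 'w \<Rightarrow> ('v, 'w) tensor"
  where "pure_tensor R V W v w =
    tensor_relations R V W #>\<^bsub>free_Abelian_group (carrier V \<times> carrier W)\<^esub> frag_of (v, w)"

text \<open>
  The homomorphism into the abelian group \<open>G\<close> that sends \<open>v \<otimes> w\<close> to \<open>b v w\<close>. It exists and is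
  unique if \<open>b\<close> is bilinear (more generally, biadditive and balanced over \<open>R\<close>), see
  \<open>tensor_lift_hom\<close> and \<open>tensor_lift_pure\<close> below.
\<close>

definition tensor_lift ::
  "('r, 'x) ring_scheme \<Rightarrow> ('r, 'v, 'y) module_scheme \<Rightarrow> ('r, 'w, 'z) module_scheme
    \<Rightarrow> ('g, 'q) monoid_scheme \<Rightarrow> ('v \<Rightarrow> 'w \<Rightarrow> 'g) \<Rightarrow> ('v, 'w) tensor \<Rightarrow> 'g"
  where "tensor_lift R V W G b =
    (THE f. f \<in> extensional (carrier (tensor_group R V W)) \<and>
            f \<in> hom (tensor_group R V W) G \<and>
            (\<forall>v \<in> carrier V. \<forall>w \<in> carrier W. f (pure_tensor R V W v w) = b v w))"

definition balanced_map ::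
  "('r, 'x) ring_scheme \<Rightarrow> ('r, 'v, 'y) module_scheme \<Rightarrow> ('r, 'w, 'z) module_scheme
    \<Rightarrow> ('g, 'q) monoid_scheme \<Rightarrow> ('v \<Rightarrow> 'w \<Rightarrow> 'g) \<Rightarrow> bool"
  where "balanced_map R V W G b \<longleftrightarrow>
    (\<forall>v \<in> carrier V. \<forall>w \<in> carrier W. b v w \<in> carrier G) \<and>
    (\<forall>u \<in> carrier V. \<forall>v \<in> carrier V. \<forall>w \<in> carrier W. b (u \<oplus>\<^bsub>V\<^esub> v) w = b u w \<otimes>\<^bsub>G\<^esub> b v w) \<and>
    (\<forall>v \<in> carrier V. \<forall>w \<in> carrier W. \<forall>x \<in> carrier W. b v (w \<oplus>\<^bsub>W\<^esub> x) = b v w \<otimes>\<^bsub>G\<^esub> b v x) \<and>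
    (\<forall>r \<in> carrier R. \<forall>v \<in> carrier V. \<forall>w \<in> carrier W. b (r \<odot>\<^bsub>V\<^esub> v) w = b v (r \<odot>\<^bsub>W\<^esub> w))"

context
  fixes R :: "('r, 'x) ring_scheme" and V :: "('r, 'v, 'y) module_scheme"
    and W :: "('r, 'w, 'z) module_scheme"
  assumes V: "module R V" and W: "module R W"
begin

interpretation V: module R V by (rule V)
interpretation W: module R W by (rule W)

private abbreviation F where "F \<equiv> free_Abelian_group (carrier V \<times> carrier W)"

lemma frag_in_free:
  "v \<in> carrier V \<Longrightarrow> w \<in> carrier W \<Longrightarrow> frag_of (v, w) \<in> carrier F"
  by simp

lemma free_add_closed: "x \<in> carrier F \<Longrightarrow> y \<in> carrier F \<Longrightarrow> x + y \<in> carrier F"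
  using monoid.m_closed[OF group.is_monoid[OF group_free_Abelian_group], of x "carrier V \<times> carrier W" y]
  by (simp del: carrier_free_Abelian_group_iff)

lemma free_diff_closed: "x \<in> carrier F \<Longrightarrow> y \<in> carrier F \<Longrightarrow> x - y \<in> carrier F"
  using free_add_closed[of x "- y"] by simp

lemma tensor_relators_closed:
  "{frag_of (u \<oplus>\<^bsub>V\<^esub> v, w) - (frag_of (u, w) + frag_of (v, w)) | u v w.
         u \<in> carrier V \<and> v \<in> carrier V \<and> w \<in> carrier W} \<union>
      {frag_of (v, w \<oplus>\<^bsub>W\<^esub> x) - (frag_of (v, w) + frag_of (v, x)) | v w x.
         v \<in> carrier V \<and> w \<in> carrier W \<and> x \<in> carrier W} \<union>
      {frag_of (r \<odot>\<^bsub>V\<^esub> v, w) - frag_of (v, r \<odot>\<^bsub>W\<^esub> w) | r v w.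
         r \<in> carrier R \<and> v \<in> carrier V \<and> w \<in> carrier W} \<subseteq> carrier F"
  by (intro Un_least subsetI; elim CollectE exE conjE; hypsubst;
        intro free_diff_closed free_add_closed frag_in_free V.a_closed W.a_closed V.smult_closed W.smult_closed; assumption)

lemma tensor_relations_normal: "tensor_relations R V W \<lhd> F"
proof -
  interpret F: comm_group F by (rule abelian_free_Abelian_group)
  show ?thesis
    unfolding tensor_relations_def
    by (intro F.subgroup_imp_normal F.generate_is_subgroup tensor_relators_closed)
qed

lemma comm_group_tensor_group: "comm_group (tensor_group R V W)"
  unfolding tensor_group_def
  by (intro comm_group.abelian_FactGroup abelian_free_Abelian_group normal_imp_subgroup
        tensor_relations_normal)

lemma pure_tensor_closed:
  "v \<in> carrier V \<Longrightarrow> w \<in> carrier W \<Longrightarrow> pure_tensor R V W v w \<in> carrier (tensor_group R V W)"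
  by (auto simp: pure_tensor_def tensor_group_def carrier_FactGroup)

lemma tensor_hom_eqI:
  assumes G: "group G"
    and f: "f \<in> hom (tensor_group R V W) G" and g: "g \<in> hom (tensor_group R V W) G"
    and eq: "\<And>v w. v \<in> carrier V \<Longrightarrow> w \<in> carrier W \<Longrightarrow>
      f (pure_tensor R V W v w) = g (pure_tensor R V W v w)"
    and t: "t \<in> carrier (tensor_group R V W)"
  shows "f t = g t"
proof -
  let ?T = "tensor_relations R V W" and ?q = "\<lambda>x. tensor_relations R V W #>\<^bsub>F\<^esub> x"
  have T: "group (tensor_group R V W)"
    using comm_group_tensor_group by (simp add: comm_group.axioms)
  have q: "?q \<in> hom F (tensor_group R V W)"
    unfolding tensor_group_def using tensor_relations_normal by (rule normal.r_coset_hom_Mod)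
  have fq: "(\<lambda>x. f (?q x)) \<in> hom F G" and gq: "(\<lambda>x. g (?q x)) \<in> hom F G"
    using hom_compose[OF q f] hom_compose[OF q g] by (simp_all add: o_def)
  interpret f: group_hom F G "\<lambda>x. f (?q x)"
    using fq G by (simp add: group_hom_def group_hom_axioms_def)
  interpret g: group_hom F G "\<lambda>x. g (?q x)"
    using gq G by (simp add: group_hom_def group_hom_axioms_def)
  obtain x where x: "Poly_Mapping.keys x \<subseteq> carrier V \<times> carrier W" "t = ?q x"
    using t by (auto simp: tensor_group_def carrier_FactGroup)
  have "f (?q x) = g (?q x)"
    using x(1)
  proof (induction x rule: free_Abelian_group_induct[consumes 1])
    case 1
    show ?case using f.hom_one g.hom_one by simp
  next
    case (2 x y)
    then have xy: "x \<in> carrier F" "y \<in> carrier F" by simp_all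
    then have eq: "x - y = x \<otimes>\<^bsub>F\<^esub> inv\<^bsub>F\<^esub> y" by simp
    show ?case
      unfolding eq
      by (simp only: f.hom_mult[OF xy(1) f.G.inv_closed[OF xy(2)]] f.hom_inv[OF xy(2)]
          g.hom_mult[OF xy(1) f.G.inv_closed[OF xy(2)]] g.hom_inv[OF xy(2)] 2)
  next
    case (3 a)
    then show ?case
      using eq by (cases a) (auto simp: pure_tensor_def)
  qed
  with x(2) show ?thesis by simp
qed

lemma tensor_lift_ex1:
  assumes G: "comm_group G" and b: "balanced_map R V W G b"
  shows "\<exists>!f. f \<in> extensional (carrier (tensor_group R V W)) \<and>
            f \<in> hom (tensor_group R V W) G \<and>
            (\<forall>v \<in> carrier V. \<forall>w \<in> carrier W. f (pure_tensor R V W v w) = b v w)"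
proof (rule ex_ex1I)
  interpret G: comm_group G by (rule G)
  obtain h where h: "h \<in> hom F G"
    and h_frag: "\<And>z. z \<in> carrier V \<times> carrier W \<Longrightarrow> h (frag_of z) = b (fst z) (snd z)"
  proof (rule G.free_Abelian_group_universal[of "\<lambda>z. b (fst z) (snd z)" "carrier V \<times> carrier W"])
    show "(\<lambda>z. b (fst z) (snd z)) ` (carrier V \<times> carrier W) \<subseteq> carrier G"
      using b by (auto simp: balanced_map_def)
  next
    fix h
    assume "h \<in> hom F G" "\<And>z. z \<in> carrier V \<times> carrier W \<Longrightarrow> h (frag_of z) = b (fst z) (snd z)"
    then show thesis by (rule that)
  qed
  interpret h: group_hom F G h
    using h G.group_axioms by (simp add: group_hom_def group_hom_axioms_def)
  have h_add: "h (x + y) = h x \<otimes>\<^bsub>G\<^esub> h y" if "x \<in> carrier F" "y \<in> carrier F" for x y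
    using h.hom_mult[OF that] by simp
  have h_diff: "h (x - y) = \<one>\<^bsub>G\<^esub>" if "x \<in> carrier F" "y \<in> carrier F" "h x = h y" for x y
  proof -
    have "x - y = x \<otimes>\<^bsub>F\<^esub> inv\<^bsub>F\<^esub> y" using that by simp
    then show ?thesis
      using that h.hom_mult[of x "inv\<^bsub>F\<^esub> y"] h.hom_inv[of y]
      by (simp del: inv_free_Abelian_group mult_free_Abelian_group carrier_free_Abelian_group_iff)
  qed
  have "tensor_relations R V W \<subseteq> kernel F G h"
    unfolding tensor_relations_def
  proof (rule h.G.generate_subgroup_incl[OF _ h.subgroup_kernel], intro subsetI)
    fix x
    assume x: "x \<in> {frag_of (u \<oplus>\<^bsub>V\<^esub> v, w) - (frag_of (u, w) + frag_of (v, w)) | u v w.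
         u \<in> carrier V \<and> v \<in> carrier V \<and> w \<in> carrier W} \<union>
      {frag_of (v, w \<oplus>\<^bsub>W\<^esub> x) - (frag_of (v, w) + frag_of (v, x)) | v w x.
         v \<in> carrier V \<and> w \<in> carrier W \<and> x \<in> carrier W} \<union>
      {frag_of (r \<odot>\<^bsub>V\<^esub> v, w) - frag_of (v, r \<odot>\<^bsub>W\<^esub> w) | r v w.
         r \<in> carrier R \<and> v \<in> carrier V \<and> w \<in> carrier W}" (is "x \<in> ?A \<union> ?B \<union> ?C")
    then consider "x \<in> ?A" | "x \<in> ?B" | "x \<in> ?C" by blast
    then have "h x = \<one>\<^bsub>G\<^esub>"
    proof cases
      case 1
      then obtain u v w where *: "u \<in> carrier V" "v \<in> carrier V" "w \<in> carrier W"
        and x: "x = frag_of (u \<oplus>\<^bsub>V\<^esub> v, w) - (frag_of (u, w) + frag_of (v, w))" by blast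
      have "h (frag_of (u \<oplus>\<^bsub>V\<^esub> v, w)) = h (frag_of (u, w) + frag_of (v, w))"
        using * b by (subst h_add) (auto simp: h_frag balanced_map_def)
      then show ?thesis
        unfolding x using * by (intro h_diff free_add_closed frag_in_free) auto
    next
      case 2
      then obtain v w z where *: "v \<in> carrier V" "w \<in> carrier W" "z \<in> carrier W"
        and x: "x = frag_of (v, w \<oplus>\<^bsub>W\<^esub> z) - (frag_of (v, w) + frag_of (v, z))" by blast
      have "h (frag_of (v, w \<oplus>\<^bsub>W\<^esub> z)) = h (frag_of (v, w) + frag_of (v, z))"
        using * b by (subst h_add) (auto simp: h_frag balanced_map_def)
      then show ?thesis
        unfolding x using * by (intro h_diff free_add_closed frag_in_free) auto
    next
      case 3
      then obtain r v w where *: "r \<in> carrier R" "v \<in> carrier V" "w \<in> carrier W"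
        and x: "x = frag_of (r \<odot>\<^bsub>V\<^esub> v, w) - frag_of (v, r \<odot>\<^bsub>W\<^esub> w)" by blast
      show ?thesis
        unfolding x using * b
        by (intro h_diff frag_in_free) (auto simp: h_frag balanced_map_def)
    qed
    then show "x \<in> kernel F G h"
      using x tensor_relators_closed by (auto simp only: kernel_def)
  qed
  from h.FactGroup_universal_kernel[OF tensor_relations_normal this]
  obtain g where g: "g \<in> hom (tensor_group R V W) G"
    and g_q: "\<And>x. x \<in> carrier F \<Longrightarrow> g (tensor_relations R V W #>\<^bsub>F\<^esub> x) = h x"
    unfolding tensor_group_def by blast
  let ?g = "restrict g (carrier (tensor_group R V W))"
  have "?g \<in> hom (tensor_group R V W) G"
    using g group.is_monoid[OF comm_group.axioms(2)[OF comm_group_tensor_group]]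
    by (auto simp: hom_def monoid.m_closed)
  moreover have "?g (pure_tensor R V W v w) = b v w" if "v \<in> carrier V" "w \<in> carrier W" for v w
    using that g_q[of "frag_of (v, w)"] h_frag[of "(v, w)"] pure_tensor_closed[OF that]
    by (simp add: pure_tensor_def)
  ultimately show "\<exists>f. f \<in> extensional (carrier (tensor_group R V W)) \<and>
            f \<in> hom (tensor_group R V W) G \<and>
            (\<forall>v \<in> carrier V. \<forall>w \<in> carrier W. f (pure_tensor R V W v w) = b v w)"
    by (intro exI[of _ ?g]) auto
next
  fix f g
  assume f: "f \<in> extensional (carrier (tensor_group R V W)) \<and>
            f \<in> hom (tensor_group R V W) G \<and>
            (\<forall>v \<in> carrier V. \<forall>w \<in> carrier W. f (pure_tensor R V W v w) = b v w)"
    and g: "g \<in> extensional (carrier (tensor_group R V W)) \<and>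
            g \<in> hom (tensor_group R V W) G \<and>
            (\<forall>v \<in> carrier V. \<forall>w \<in> carrier W. g (pure_tensor R V W v w) = b v w)"
  show "f = g"
    using f g tensor_hom_eqI[OF comm_group.axioms(2)[OF G], of f g]
    by (intro extensionalityI[of f "carrier (tensor_group R V W)" g]) auto
qed

lemma tensor_lift_hom:
  assumes "comm_group G" and "balanced_map R V W G b"
  shows "tensor_lift R V W G b \<in> hom (tensor_group R V W) G"
  using theI'[OF tensor_lift_ex1[OF assms]] unfolding tensor_lift_def by blast

lemma tensor_lift_pure:
  assumes "comm_group G" and "balanced_map R V W G b"
    and "v \<in> carrier V" and "w \<in> carrier W"
  shows "tensor_lift R V W G b (pure_tensor R V W v w) = b v w"
  using theI'[OF tensor_lift_ex1[OF assms(1,2)]] assms(3,4) unfolding tensor_lift_def by blast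

end

definition tensor_product ::
  "('r, 'x) ring_scheme \<Rightarrow> ('r, 'v, 'y) module_scheme \<Rightarrow> ('r, 'w, 'z) module_scheme
    \<Rightarrow> ('r, ('v, 'w) tensor) module"
  where "tensor_product R V W =
    \<lparr>carrier = carrier (tensor_group R V W),
     monoid.mult = (\<lambda>s t. tensor_lift R V W (tensor_group R V W)
               (\<lambda>v w. tensor_lift R V W (tensor_group R V W)
                  (\<lambda>v' w'. pure_tensor R V W (v \<otimes>\<^bsub>V\<^esub> v') (w \<otimes>\<^bsub>W\<^esub> w')) t) s),
     monoid.one = pure_tensor R V W \<one>\<^bsub>V\<^esub> \<one>\<^bsub>W\<^esub>,
     ring.zero = monoid.one (tensor_group R V W),
     ring.add = monoid.mult (tensor_group R V W),
     smult = (\<lambda>r. tensor_lift R V W (tensor_group R V W)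
               (\<lambda>v w. pure_tensor R V W (r \<odot>\<^bsub>V\<^esub> v) w))\<rparr>"


section \<open>Hopf algebras\<close>

record ('r, 'h) hopf = "('r, 'h) module" +
  comult :: "'h \<Rightarrow> ('h, 'h) tensor"
  counit :: "'h \<Rightarrow> 'r"
  antipode :: "'h \<Rightarrow> 'h"

text \<open>The locale \<open>algebra\<close> of HOL-Algebra only covers commutative algebras.\<close>

definition assoc_algebra :: "('r, 'x) ring_scheme \<Rightarrow> ('r, 'a, 'y) module_scheme \<Rightarrow> bool"
  where "assoc_algebra R A \<longleftrightarrow> module R A \<and> ring A \<and>
    (\<forall>r \<in> carrier R. \<forall>a \<in> carrier A. \<forall>b \<in> carrier A.
       (r \<odot>\<^bsub>A\<^esub> a) \<otimes>\<^bsub>A\<^esub> b = r \<odot>\<^bsub>A\<^esub> (a \<otimes>\<^bsub>A\<^esub> b) \<and>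
       a \<otimes>\<^bsub>A\<^esub> (r \<odot>\<^bsub>A\<^esub> b) = r \<odot>\<^bsub>A\<^esub> (a \<otimes>\<^bsub>A\<^esub> b))"

text \<open>
  Both sides of the coassociativity law are evaluated in \<open>H \<otimes> (H \<otimes> H)\<close>: the left-hand side is
  \<open>\<Delta> \<otimes> id\<close> followed by the canonical isomorphism \<open>(H \<otimes> H) \<otimes> H \<rightarrow> H \<otimes> (H \<otimes> H)\<close>.
\<close>

definition coassociative :: "('r, 'x) ring_scheme \<Rightarrow> ('r, 'h, 'y) hopf_scheme \<Rightarrow> bool"
  where "coassociative R H \<longleftrightarrow>
    (let HH = tensor_product R H H; G = tensor_group R H HH in
     \<forall>h \<in> carrier H.
       tensor_lift R H H G
         (\<lambda>a b. tensor_lift R H H G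
            (\<lambda>c d. pure_tensor R H HH c (pure_tensor R H H d b)) (comult H a)) (comult H h) =
       tensor_lift R H H G (\<lambda>a b. pure_tensor R H HH a (comult H b)) (comult H h))"

definition counital :: "('r, 'x) ring_scheme \<Rightarrow> ('r, 'h, 'y) hopf_scheme \<Rightarrow> bool"
  where "counital R H \<longleftrightarrow>
    (\<forall>h \<in> carrier H.
       tensor_lift R H H (add_monoid H) (\<lambda>a b. counit H a \<odot>\<^bsub>H\<^esub> b) (comult H h) = h \<and>
       tensor_lift R H H (add_monoid H) (\<lambda>a b. counit H b \<odot>\<^bsub>H\<^esub> a) (comult H h) = h)"

definition hopf_algebra :: "('r, 'x) ring_scheme \<Rightarrow> ('r, 'h, 'y) hopf_scheme \<Rightarrow> bool"
  where "hopf_algebra R H \<longleftrightarrow>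
    assoc_algebra R H \<and>
    comult H \<in> linear_maps R H (tensor_product R H H) \<and>
    comult H \<in> ring_hom H (tensor_product R H H) \<and>
    counit H \<in> linear_maps R H (regular_module R) \<and>
    counit H \<in> ring_hom H R \<and>
    coassociative R H \<and> counital R H \<and>
    antipode H \<in> linear_maps R H H \<and>
    (\<forall>h \<in> carrier H.
       tensor_lift R H H (add_monoid H) (\<lambda>a b. antipode H a \<otimes>\<^bsub>H\<^esub> b) (comult H h) =
         counit H h \<odot>\<^bsub>H\<^esub> \<one>\<^bsub>H\<^esub> \<and>
       tensor_lift R H H (add_monoid H) (\<lambda>a b. a \<otimes>\<^bsub>H\<^esub> antipode H b) (comult H h) =
         counit H h \<odot>\<^bsub>H\<^esub> \<one>\<^bsub>H\<^esub>)"

definition cocommutative :: "('r, 'x) ring_scheme \<Rightarrow> ('r, 'h, 'y) hopf_scheme \<Rightarrow> bool"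
  where "cocommutative R H \<longleftrightarrow>
    (\<forall>h \<in> carrier H.
       tensor_lift R H H (tensor_group R H H) (\<lambda>a b. pure_tensor R H H b a) (comult H h) =
       comult H h)"

definition finitely_generated_module :: "('r, 'x) ring_scheme \<Rightarrow> ('r, 'v, 'y) module_scheme \<Rightarrow> bool"
  where "finitely_generated_module R V \<longleftrightarrow>
    (\<exists>B. finite B \<and> B \<subseteq> carrier V \<and>
       (\<forall>v \<in> carrier V. \<exists>c \<in> B \<rightarrow> carrier R. v = (\<Oplus>\<^bsub>V\<^esub>b\<in>B. c b \<odot>\<^bsub>V\<^esub> b)))"

definition module_algebra ::
  "('r, 'x) ring_scheme \<Rightarrow> ('r, 'h, 'y) hopf_scheme \<Rightarrow> ('r, 'a, 'z) module_scheme
    \<Rightarrow> ('h \<Rightarrow> 'a \<Rightarrow> 'a) \<Rightarrow> bool"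
  where "module_algebra R H A \<mu> \<longleftrightarrow>
    \<mu> \<in> linear_maps R H (End_algebra R A) \<and>
    \<mu> \<in> ring_hom H (End_algebra R A) \<and>
    (\<forall>h \<in> carrier H.
       (\<forall>x \<in> carrier A. \<forall>y \<in> carrier A.
          \<mu> h (x \<otimes>\<^bsub>A\<^esub> y) =
          tensor_lift R H H (add_monoid A) (\<lambda>a b. \<mu> a x \<otimes>\<^bsub>A\<^esub> \<mu> b y) (comult H h)) \<and>
       \<mu> h \<one>\<^bsub>A\<^esub> = counit H h \<odot>\<^bsub>A\<^esub> \<one>\<^bsub>A\<^esub>)"


section \<open>Field extensions\<close>

text \<open>
  An extension \<open>L/K\<close> is given by subfields \<open>K \<subseteq> L\<close> of a field \<open>M\<close>, which will be a normal closure
  of \<open>L/K\<close>.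
\<close>

definition normal_closure :: "'m ring \<Rightarrow> 'm set \<Rightarrow> 'm set \<Rightarrow> bool"
  where "normal_closure M K L \<longleftrightarrow>
    (\<forall>x \<in> L. (ring.algebraic M over K) x \<and> ring.splitted M (ring.Irr M K x)) \<and>
    carrier M =
      generate_field M {a \<in> carrier M. \<exists>x \<in> L. ring.eval M (ring.Irr M K x) a = \<zero>\<^bsub>M\<^esub>}"

text \<open>
  Multiplicities are counted in \<open>M\<close>; this is the usual notion of separability as soon as the
  minimal polynomials over \<open>K\<close> of the elements of \<open>L\<close> split over \<open>M\<close>, in particular if \<open>M\<close> is a
  normal closure of \<open>L/K\<close>.
\<close>

definition separable_extension :: "'m ring \<Rightarrow> 'm set \<Rightarrow> 'm set \<Rightarrow> bool"
  where "separable_extension M K L \<longleftrightarrow>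
    (\<forall>x \<in> L. (ring.algebraic M over K) x \<and>
       (\<forall>a \<in> carrier M. ring.alg_mult M (ring.Irr M K x) a \<le> 1))"

definition Gal :: "'m ring \<Rightarrow> 'm set \<Rightarrow> ('m \<Rightarrow> 'm) monoid"
  where "Gal M E =
    (BijGroup (carrier M))
      \<lparr>carrier := {\<sigma> \<in> ring_iso M M \<inter> extensional (carrier M). \<forall>x \<in> E. \<sigma> x = x}\<rparr>"


section \<open>Hopf Galois structures\<close>

definition hopf_galois_structure ::
  "'m ring \<Rightarrow> 'm set \<Rightarrow> 'm set \<Rightarrow> ('m, 'h) hopf \<Rightarrow> ('h \<Rightarrow> 'm \<Rightarrow> 'm) \<Rightarrow> bool"
  where "hopf_galois_structure M K L H \<mu> \<longleftrightarrow>
    (let k = M\<lparr>carrier := K\<rparr>; l = regular_module (M\<lparr>carrier := L\<rparr>) in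
     hopf_algebra k H \<and> cocommutative k H \<and> finitely_generated_module k H \<and>
     module_algebra k H l \<mu> \<and>
     tensor_lift k l H (add_monoid (End_algebra k l)) (\<lambda>x h. \<lambda>y \<in> L. x \<otimes>\<^bsub>M\<^esub> \<mu> h y)
       \<in> linear_isos k (tensor_product k l H) (End_algebra k l))"

definition hopf_galois_iso ::
  "'m ring \<Rightarrow> 'm set \<Rightarrow> ('m, 'h) hopf \<Rightarrow> ('h \<Rightarrow> 'm \<Rightarrow> 'm)
    \<Rightarrow> ('m, 'i) hopf \<Rightarrow> ('i \<Rightarrow> 'm \<Rightarrow> 'm) \<Rightarrow> ('h \<Rightarrow> 'i) \<Rightarrow> bool"
  where "hopf_galois_iso M K H \<mu> H' \<mu>' \<phi> \<longleftrightarrow>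
    (let k = M\<lparr>carrier := K\<rparr> in
     \<phi> \<in> linear_isos k H H' \<and> \<phi> \<in> ring_hom H H' \<and>
     (\<forall>h \<in> carrier H.
        comult H' (\<phi> h) =
          tensor_lift k H H (tensor_group k H' H')
            (\<lambda>a b. pure_tensor k H' H' (\<phi> a) (\<phi> b)) (comult H h) \<and>
        counit H' (\<phi> h) = counit H h \<and>
        antipode H' (\<phi> h) = \<phi> (antipode H h) \<and>
        \<mu>' (\<phi> h) = \<mu> h))"


section \<open>The Greither--Pareigis correspondence\<close>

type_synonym 'm coset_perm = "('m \<Rightarrow> 'm) set \<Rightarrow> ('m \<Rightarrow> 'm) set"

definition coset_space :: "'m ring \<Rightarrow> 'm set \<Rightarrow> 'm set \<Rightarrow> ('m \<Rightarrow> 'm) set set"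
  where "coset_space M K L = lcosets\<^bsub>Gal M K\<^esub> (carrier (Gal M L))"

definition left_translation :: "'m ring \<Rightarrow> 'm set \<Rightarrow> 'm set \<Rightarrow> ('m \<Rightarrow> 'm) \<Rightarrow> 'm coset_perm"
  where "left_translation M K L g = (\<lambda>C \<in> coset_space M K L. g <#\<^bsub>Gal M K\<^esub> C)"

abbreviation conj_by :: "('g, 'x) monoid_scheme \<Rightarrow> 'g \<Rightarrow> 'g \<Rightarrow> 'g"
  where "conj_by G g x \<equiv> g \<otimes>\<^bsub>G\<^esub> x \<otimes>\<^bsub>G\<^esub> inv\<^bsub>G\<^esub> g"

definition regular_subgroup :: "'x set \<Rightarrow> ('x \<Rightarrow> 'x) set \<Rightarrow> bool"
  where "regular_subgroup S N \<longleftrightarrow>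
    subgroup N (BijGroup S) \<and> (\<forall>x \<in> S. \<forall>y \<in> S. \<exists>!f. f \<in> N \<and> f x = y)"

definition normalized_by_Gal :: "'m ring \<Rightarrow> 'm set \<Rightarrow> 'm set \<Rightarrow> 'm coset_perm set \<Rightarrow> bool"
  where "normalized_by_Gal M K L N \<longleftrightarrow>
    (\<forall>g \<in> carrier (Gal M K). \<forall>\<eta> \<in> N.
       conj_by (BijGroup (coset_space M K L)) (left_translation M K L g) \<eta> \<in> N)"

text \<open>
  The group algebra of a finite group \<open>T\<close>: the function \<open>a\<close> stands for the formal sum
  \<open>\<Sum>t. a t \<cdot> t\<close>, and every group element \<open>t\<close> is group-like.
\<close>

definition group_element :: "('r, 'x) ring_scheme \<Rightarrow> ('t, 'y) monoid_scheme \<Rightarrow> 't \<Rightarrow> 't \<Rightarrow> 'r"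
  where "group_element R T t = (\<lambda>s \<in> carrier T. if s = t then \<one>\<^bsub>R\<^esub> else \<zero>\<^bsub>R\<^esub>)"

definition group_algebra ::
  "('r, 'x) ring_scheme \<Rightarrow> ('t, 'y) monoid_scheme \<Rightarrow> ('r, 't \<Rightarrow> 'r) module"
  where "group_algebra R T =
    \<lparr>carrier = carrier T \<rightarrow>\<^sub>E carrier R,
     monoid.mult = (\<lambda>a b. \<lambda>t \<in> carrier T. \<Oplus>\<^bsub>R\<^esub>s\<in>carrier T. a s \<otimes>\<^bsub>R\<^esub> b (inv\<^bsub>T\<^esub> s \<otimes>\<^bsub>T\<^esub> t)),
     monoid.one = group_element R T \<one>\<^bsub>T\<^esub>,
     ring.zero = (\<lambda>t \<in> carrier T. \<zero>\<^bsub>R\<^esub>),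
     ring.add = (\<lambda>a b. \<lambda>t \<in> carrier T. a t \<oplus>\<^bsub>R\<^esub> b t),
     smult = (\<lambda>r a. \<lambda>t \<in> carrier T. r \<otimes>\<^bsub>R\<^esub> a t)\<rparr>"

definition group_algebra_comult ::
  "('r, 'x) ring_scheme \<Rightarrow> ('t, 'y) monoid_scheme \<Rightarrow> ('t \<Rightarrow> 'r) \<Rightarrow> ('t \<Rightarrow> 'r, 't \<Rightarrow> 'r) tensor"
  where "group_algebra_comult R T a =
    (let A = group_algebra R T in
     \<Oplus>\<^bsub>tensor_product R A A\<^esub>t\<in>carrier T.
       a t \<odot>\<^bsub>tensor_product R A A\<^esub> pure_tensor R A A (group_element R T t) (group_element R T t))"

definition fixed_algebra ::
  "'m ring \<Rightarrow> 'm set \<Rightarrow> 'm set \<Rightarrow> 'm coset_perm set \<Rightarrow> ('m, 'm coset_perm \<Rightarrow> 'm) module"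
  where "fixed_algebra M K L N =
    (let S = BijGroup (coset_space M K L); A = group_algebra M (S\<lparr>carrier := N\<rparr>) in
     A\<lparr>carrier := {a \<in> carrier A. \<forall>g \<in> carrier (Gal M K). \<forall>\<eta> \<in> N.
                     a (conj_by S (left_translation M K L g) \<eta>) = g (a \<eta>)}\<rparr>)"

text \<open>
  The \<open>K\<close>-Hopf algebra \<open>M[N]\<^sup>G\<close>, where \<open>G = Gal M K\<close>. By Galois descent the canonical map
  \<open>M[N]\<^sup>G \<otimes>\<^sub>K M[N]\<^sup>G \<rightarrow> M[N] \<otimes>\<^sub>M M[N]\<close> is injective and its image contains the
  comultiplication of \<open>M[N]\<close> of all elements of \<open>M[N]\<^sup>G\<close>; the comultiplication
  of \<open>M[N]\<^sup>G\<close> is the restriction of the one of \<open>M[N]\<close> along this map.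
\<close>

definition fixed_hopf_algebra ::
  "'m ring \<Rightarrow> 'm set \<Rightarrow> 'm set \<Rightarrow> 'm coset_perm set \<Rightarrow> ('m, 'm coset_perm \<Rightarrow> 'm) hopf"
  where "fixed_hopf_algebra M K L N =
    (let k = M\<lparr>carrier := K\<rparr>;
         T = (BijGroup (coset_space M K L))\<lparr>carrier := N\<rparr>;
         A = group_algebra M T;
         F = fixed_algebra M K L N
     in \<lparr>carrier = carrier F, monoid.mult = monoid.mult F, monoid.one = monoid.one F,
         ring.zero = ring.zero F, ring.add = ring.add F, smult = smult F,
         comult = (\<lambda>a. THE t. t \<in> carrier (tensor_group k F F) \<and>
                     tensor_lift k F F (tensor_group M A A) (pure_tensor M A A) t =
                     group_algebra_comult M T a),
         counit = (\<lambda>a. \<Oplus>\<^bsub>M\<^esub>\<eta>\<in>N. a \<eta>),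
         antipode = (\<lambda>a. \<lambda>\<eta> \<in> N. a (inv\<^bsub>T\<^esub> \<eta>))\<rparr>)"

text \<open>
  An element \<open>\<Sum>\<eta>. a \<eta> \<cdot> \<eta>\<close> of \<open>M[N]\<^sup>G\<close> acts on \<open>x \<in> L\<close> by \<open>\<Sum>\<eta>. a \<eta> \<cdot> g\<^sub>\<eta> x\<close>, where \<open>g\<^sub>\<eta>\<close> is any
  representative of the coset \<open>\<eta>\<inverse>(G')\<close> and \<open>G' = Gal M L\<close>. As \<open>G'\<close> fixes \<open>L\<close>, the value
  \<open>g\<^sub>\<eta> x\<close> does not depend on the choice.
\<close>

definition fixed_hopf_action ::
  "'m ring \<Rightarrow> 'm set \<Rightarrow> 'm set \<Rightarrow> 'm coset_perm set \<Rightarrow> ('m coset_perm \<Rightarrow> 'm) \<Rightarrow> 'm \<Rightarrow> 'm"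
  where "fixed_hopf_action M K L N a =
    (\<lambda>x \<in> L. \<Oplus>\<^bsub>M\<^esub>\<eta>\<in>N. a \<eta> \<otimes>\<^bsub>M\<^esub>
       (THE y. \<forall>g \<in> (inv\<^bsub>BijGroup (coset_space M K L)\<^esub> \<eta>) (carrier (Gal M L)). g x = y))"

text \<open>
  \<open>corresponding_subgroup M K L H \<mu> N\<close>: the Hopf Galois structure \<open>(H, \<mu>)\<close> on \<open>L/K\<close> is
  the one that corresponds to \<open>N\<close>. The type of \<open>(H, \<mu>)\<close> is the isomorphism class of \<open>N\<close>.
\<close>

definition corresponding_subgroup ::
  "'m ring \<Rightarrow> 'm set \<Rightarrow> 'm set \<Rightarrow> ('m, 'h) hopf \<Rightarrow> ('h \<Rightarrow> 'm \<Rightarrow> 'm) \<Rightarrow> 'm coset_perm set \<Rightarrow> bool"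
  where "corresponding_subgroup M K L H \<mu> N \<longleftrightarrow>
    regular_subgroup (coset_space M K L) N \<and>
    normalized_by_Gal M K L N \<and>
    (\<exists>\<phi>. hopf_galois_iso M K H \<mu>
            (fixed_hopf_algebra M K L N) (fixed_hopf_action M K L N) \<phi>)"

definition hopf_galois_type ::
  "'m ring \<Rightarrow> 'm set \<Rightarrow> 'm set \<Rightarrow> ('m, 'h) hopf \<Rightarrow> ('h \<Rightarrow> 'm \<Rightarrow> 'm) \<Rightarrow> 't monoid \<Rightarrow> bool"
  where "hopf_galois_type M K L H \<mu> T \<longleftrightarrow>
    (\<exists>N. corresponding_subgroup M K L H \<mu> N \<and>
         (BijGroup (coset_space M K L))\<lparr>carrier := N\<rparr> \<cong> T)"

end

theory Submission
  imports Defs "HOL-Number_Theory.Cong"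
begin

text \<open>
  The Hopf Galois structures yield two regular subgroups \<open>N\<close> (cyclic) and \<open>N'\<close> of the symmetric
  group of \<open>G/G'\<close>, both normalized by the transitive group \<open>\<lambda>(G)\<close>. The normalizer of \<open>N\<close> is the
  affine group of the integers modulo \<open>p\<^sup>n\<close>, and as \<open>p\<close> is odd, a transitive subgroup of it
  contains a \<open>p\<^sup>n\<close>-cycle \<open>\<sigma>\<close>. Conjugation by \<open>\<sigma>\<close> is an automorphism \<open>\<theta>\<close> of \<open>N'\<close>, and for
  some \<open>g\<close> in \<open>N'\<close> the map \<open>x \<mapsto> \<theta>(x) g\<close> is a single cycle on \<open>N'\<close>. This
  passes to the Frattini quotient of \<open>N'\<close>, where with \<open>\<delta> = \<theta> - 1\<close> the \<open>k\<close>-th point of the cycle is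
  \<open>k g + (k choose 2) \<delta>(g)\<close> modulo the image of \<open>\<delta>\<^sup>2\<close>. For odd \<open>p\<close> this has period \<open>p\<close> in \<open>k\<close>, which
  forces the images of \<open>\<delta>\<close> and \<open>\<delta>\<^sup>2\<close> to agree; after a translation \<open>\<theta>\<close> fixes \<open>g\<close>, and the
  cycle consists of the multiples of \<open>g\<close>. So the Frattini quotient is cyclic, and hence \<open>N'\<close> is.
\<close>

section \<open>Affine maps modulo prime powers\<close>

text \<open>Cutting the \<open>k * m\<close> terms into \<open>m\<close> blocks of length
  \<open>k\<close> is what lets a factor \<open>p\<close> of the number of terms be peeled off
  below.\<close>

lemma geometric_sum_mult:
  fixes a :: "'a::comm_semiring_1"
  shows "(\<Sum>i<k * m. a ^ i) = (\<Sum>i<k. a ^ i) * (\<Sum>j<m. (a ^ k) ^ j)"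
proof (induction m)
  case (Suc m)
  have "(\<Sum>i<k * Suc m. a ^ i) = (\<Sum>i<k * m. a ^ i) + (\<Sum>i<k. a ^ (k * m + i))"
  proof -
    have "(\<Sum>i<l + k. a ^ i) = (\<Sum>i<l. a ^ i) + (\<Sum>i<k. a ^ (l + i))" for l
      by (induction k) (auto simp: add_ac)
    from this[of "k * m"] show ?thesis by (simp add: add.commute)
  qed
  then show ?case
    using Suc
    by (simp add: power_add power_mult sum_distrib_right distrib_left mult.commute del: mult_Suc_right)
qed simp

text \<open>The binomial expansion to first order in \<open>p * t\<close>; the discarded terms carry
  the factor \<open>p\<^sup>2\<close>.\<close>

lemma cong_power_one_plus:
  fixes p t :: int
  shows "[(1 + p * t) ^ i = 1 + int i * (p * t)] (mod p\<^sup>2)"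
proof (induction i)
  case (Suc i)
  have "[(1 + p * t) ^ i * (1 + p * t) = (1 + int i * (p * t)) * (1 + p * t)] (mod p\<^sup>2)"
    using Suc by (rule cong_mult) simp
  also have "(1 + int i * (p * t)) * (1 + p * t) = 1 + int (Suc i) * (p * t) + p\<^sup>2 * (int i * t\<^sup>2)"
    by (simp add: algebra_simps power2_eq_square)
  also have "[\<dots> = 1 + int (Suc i) * (p * t)] (mod p\<^sup>2)"
    by (simp add: cong_iff_dvd_diff)
  finally show ?case by (simp add: mult.commute)
qed simp

text \<open>The linear terms add up to a multiple of \<open>p\<close> times
  \<open>0 + 1 + ... + (p - 1)\<close>, which for odd \<open>p\<close> is itself a multiple of
  \<open>p\<close>. Oddness matters: for \<open>p = 2\<close> and \<open>a = 3\<close> the sum is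
  \<open>4\<close>, which is not \<open>2\<close> modulo \<open>4\<close>.\<close>

lemma geometric_sum_prime_cong:
  fixes a :: int
  assumes "odd p" and "[a = 1] (mod int p)"
  shows "[(\<Sum>i<p. a ^ i) = int p] (mod (int p)\<^sup>2)"
proof -
  obtain t where t: "a = 1 + int p * t"
    using assms(2) by (metis cong_iff_lin cong_sym)
  obtain r where r: "p = Suc (2 * r)"
    using assms(1) by (metis oddE Suc_eq_plus1)
  have "[(\<Sum>i<p. a ^ i) = (\<Sum>i<p. 1 + int i * (int p * t))] (mod (int p)\<^sup>2)"
    unfolding t by (intro cong_sum cong_power_one_plus)
  also have "(\<Sum>i<p. 1 + int i * (int p * t)) = int p + (\<Sum>i<p. int i) * (int p * t)"
    by (simp add: sum.distrib sum_distrib_right)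
  also have "(\<Sum>i<p. int i) = int p * int r"
  proof -
    have "(\<Sum>i<Suc (2 * r). int i) = int (Suc (2 * r)) * int r" for r
      by (induction r) (auto simp: algebra_simps)
    then show ?thesis unfolding r .
  qed
  also have "int p + int p * int r * (int p * t) = int p + (int p)\<^sup>2 * (int r * t)"
    by (simp add: power2_eq_square)
  also have "[\<dots> = int p] (mod (int p)\<^sup>2)"
    by (simp add: cong_iff_dvd_diff)
  finally show ?thesis .
qed

text \<open>Modulo \<open>p\<close> the sum is \<open>m\<close>, so \<open>m = p * m'\<close>. The
  block of length \<open>p\<close> is \<open>p\<close> times a number prime to \<open>p\<close>, and
  the remaining sum has \<open>m'\<close> terms and ratio \<open>a ^ p\<close>, still
  \<open>1\<close> modulo \<open>p\<close>. Hence \<open>a\<close> has to vary in the induction on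
  \<open>j\<close>.\<close>

lemma prime_power_dvd_geometric_sum:
  fixes a :: int
  assumes p: "Factorial_Ring.prime p" "odd p"
  shows "[a = 1] (mod int p) \<Longrightarrow> int p ^ j dvd (\<Sum>i<m. a ^ i) \<Longrightarrow> p ^ j dvd m"
proof (induction j arbitrary: a m)
  case (Suc j)
  have p0: "int p \<noteq> 0" using p(1) by auto
  have "[(\<Sum>i<m. a ^ i) = (\<Sum>i<m. 1 ^ i)] (mod int p)"
    by (intro cong_sum cong_pow Suc.prems)
  moreover have "int p dvd (\<Sum>i<m. a ^ i)"
    using Suc.prems(2) by (metis dvd_mult_left power_Suc)
  ultimately have "int p dvd int m"
    by (simp add: cong_dvd_iff)
  then obtain m' where m: "m = p * m'" by auto
  obtain u where u: "(\<Sum>i<p. a ^ i) = int p + (int p)\<^sup>2 * u"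
    using geometric_sum_prime_cong[OF p(2) Suc.prems(1)] by (metis cong_iff_lin cong_sym)
  let ?s = "\<Sum>j<m'. (a ^ p) ^ j"
  have "int p * int p ^ j dvd int p * ((1 + int p * u) * ?s)"
    using Suc.prems(2) unfolding m geometric_sum_mult u by (simp add: algebra_simps power2_eq_square)
  then have "int p ^ j dvd (1 + int p * u) * ?s"
    using p0 by simp
  moreover have "coprime (int p ^ j) (1 + int p * u)"
  proof -
    have "coprime (int p) (1 + int p * u)"
      by (metis coprime_1_right coprime_iff_gcd_eq_1 gcd_add_mult mult.commute add.commute)
    then show ?thesis by simp
  qed
  ultimately have "int p ^ j dvd ?s"
    by (simp add: coprime_dvd_mult_right_iff)
  moreover have "[a ^ p = 1] (mod int p)"
    using cong_pow[OF Suc.prems(1), of p] by simp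
  ultimately have "p ^ j dvd m'"
    by (rule Suc.IH[rotated])
  then show ?case by (simp add: m)
qed simp

text \<open>The identification of the point \<open>e i\<close> with the class of \<open>i\<close> turns the maps in \<open>\<Lambda>\<close> into
  affine maps over the integers modulo \<open>p\<^sup>n\<close>. An element whose linear part is not
  \<open>1\<close> modulo \<open>p\<close> fixes a point \<open>f\<close> modulo \<open>p\<close>; its commutator with an element that moves \<open>f\<close>
  to \<open>f + 1\<close> is a translation by a unit.\<close>

lemma transitive_affine_obtains_unipotent:
  fixes e :: "int \<Rightarrow> 's" and \<Lambda> :: "('s \<Rightarrow> 's) set"
  assumes p: "Factorial_Ring.prime p" and n: "n \<noteq> 0"
    and e: "\<And>i j. e i = e j \<longleftrightarrow> [i = j] (mod int p ^ n)"
    and affine: "\<And>f. f \<in> \<Lambda> \<Longrightarrow> \<exists>a b. \<forall>i. f (e i) = e (a * i + b)"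
    and comp: "\<And>f g. f \<in> \<Lambda> \<Longrightarrow> g \<in> \<Lambda> \<Longrightarrow> \<exists>h \<in> \<Lambda>. \<forall>i. h (e i) = f (g (e i))"
    and inverse: "\<And>f. f \<in> \<Lambda> \<Longrightarrow> \<exists>g \<in> \<Lambda>. \<forall>i. f (g (e i)) = e i"
    and trans: "\<And>i j. \<exists>f \<in> \<Lambda>. f (e i) = e j"
  obtains f a b where "f \<in> \<Lambda>" "\<And>i. f (e i) = e (a * i + b)" "[a = 1] (mod int p)" "\<not> int p dvd b"
proof -
  have mod_p: "[i = j] (mod int p)" if "e i = e j" for i j
    using that n by (metis cong_dvd_modulus dvd_power e neq0_conv)
  have prime: "Factorial_Ring.prime (int p)" using p by simp
  obtain g where g: "g \<in> \<Lambda>" "g (e 0) = e 1" using trans by blast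
  obtain a b where ab: "\<And>i. g (e i) = e (a * i + b)" using affine[OF g(1)] by blast
  have b: "[b = 1] (mod int p)" using ab[of 0] g(2) mod_p by simp
  show thesis
  proof (cases "[a = 1] (mod int p)")
    case True
    moreover have "\<not> int p dvd b"
      using b prime by (metis cong_dvd_iff not_prime_unit)
    ultimately show ?thesis using that g(1) ab by blast
  next
    case False
    then have "\<not> int p dvd 1 - a"
      by (metis cong_iff_dvd_diff cong_sym)
    then have "coprime (1 - a) (int p)"
      using prime by (metis coprime_commute prime_imp_coprime)
    \<comment> \<open>As \<open>b\<close> is \<open>1\<close> modulo \<open>p\<close>, the solution
      \<open>f\<close> is the class that \<open>g\<close> fixes modulo \<open>p\<close>.\<close>
    then obtain f where f: "[(1 - a) * f = 1] (mod int p)"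
      using cong_solve_coprime_int by blast
    obtain h where h: "h \<in> \<Lambda>" "h (e f) = e (f + 1)" using trans by blast
    obtain a' b' where ab': "\<And>i. h (e i) = e (a' * i + b')" using affine[OF h(1)] by blast
    have b': "[a' * f + b' = f + 1] (mod int p)" using ab'[of f] h(2) mod_p by simp
    obtain hg where hg: "hg \<in> \<Lambda>" "\<And>i. hg (e i) = h (g (e i))" using comp[OF h(1) g(1)] by blast
    obtain gh where gh: "gh \<in> \<Lambda>" "\<And>i. gh (e i) = g (h (e i))" using comp[OF g(1) h(1)] by blast
    obtain k where k: "k \<in> \<Lambda>" "\<And>i. hg (k (e i)) = e i" using inverse[OF hg(1)] by blast
    \<comment> \<open>\<open>t\<close> is \<open>gh\<close> after the inverse of \<open>hg\<close>,
      the commutator of \<open>g\<close> and \<open>h\<close>. Linear parts commute, so it is the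
      translation by the difference \<open>c\<close> of the two constant terms.\<close>
    obtain t where t: "t \<in> \<Lambda>" "\<And>i. t (e i) = gh (k (e i))" using comp[OF gh(1) k(1)] by blast
    define c where "c = (a * b' + b) - (a' * b + b')"
    have "t (e i) = e (1 * i + c)" for i
    proof -
      obtain j where j: "k (e i) = e j" using affine[OF k(1)] by blast
      then have "e (a' * (a * j + b) + b') = e i"
        using k(2)[of i] by (simp add: hg ab ab')
      then have "[a' * (a * j + b) + b' + c = i + c] (mod int p ^ n)"
        unfolding e by (intro cong_add) auto
      moreover have "a' * (a * j + b) + b' + c = a * (a' * j + b') + b"
        by (simp add: c_def algebra_simps)
      ultimately show ?thesis
        by (simp add: t j gh ab ab' e)
    qed
    moreover have "\<not> int p dvd c"
    proof -
      \<comment> \<open>With the three congruences written as equations, \<open>c\<close> reduces to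
        \<open>a - 1\<close> modulo \<open>p\<close>, which is nonzero in this case.\<close>
      obtain x where x: "b = 1 + int p * x" using b by (metis cong_iff_lin cong_sym)
      obtain y where y: "(1 - a) * f = 1 + int p * y" using f by (metis cong_iff_lin cong_sym)
      obtain z where z: "a' * f + b' = f + 1 + int p * z" using b' by (metis cong_iff_lin cong_sym)
      have b'': "b' = f + 1 + int p * z - a' * f" using z by simp
      have "c = (a - 1) * b' - (a' - 1) * b" by (simp add: c_def algebra_simps)
      also have "\<dots> = (1 - a) * f * (a' - 1) - (1 - a) * (1 + int p * z) - (a' - 1) * b"
        unfolding b'' by (simp add: algebra_simps)
      also have "\<dots> = int p * (y * (a' - 1) - (1 - a) * z - (a' - 1) * x) - (1 - a)"
        unfolding y x by (simp add: algebra_simps)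
      finally show ?thesis
        using \<open>\<not> int p dvd 1 - a\<close> by (simp add: dvd_diff_right_iff)
    qed
    ultimately show ?thesis using that[OF t(1), of 1 c] by simp
  qed
qed

text \<open>The positions of the \<open>k\<close>-th and \<open>l\<close>-th iterates differ by a
  unit times a geometric sum with \<open>l - k\<close> terms, so they coincide only if
  \<open>p ^ n\<close> divides \<open>l - k\<close>. The first \<open>p ^ n\<close> iterates are
  therefore distinct and exhaust the at most \<open>p ^ n\<close> points.\<close>

lemma unipotent_affine_orbit:
  fixes e :: "int \<Rightarrow> 's"
  assumes p: "Factorial_Ring.prime p" "odd p"
    and e: "\<And>i j. e i = e j \<longleftrightarrow> [i = j] (mod int p ^ n)"
    and f: "\<And>i. f (e i) = e (a * i + b)" and a: "[a = 1] (mod int p)" and b: "\<not> int p dvd b"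
  shows "\<exists>k. (f ^^ k) (e 0) = e i"
proof -
  have fk: "(f ^^ k) (e 0) = e (b * (\<Sum>i<k. a ^ i))" for k
  proof (induction k)
    case (Suc k)
    have "a * (\<Sum>i<k. a ^ i) + 1 = (\<Sum>i<Suc k. a ^ i)"
      by (subst sum.lessThan_Suc_shift) (simp add: sum_distrib_left)
    then have "a * (b * (\<Sum>i<k. a ^ i)) + b = b * (\<Sum>i<Suc k. a ^ i)"
      by (metis distrib_left mult.left_commute mult.right_neutral)
    then show ?case using Suc by (simp add: f del: sum.lessThan_Suc)
  qed simp
  have a0: "coprime a (int p)"
    using a by (metis cong_imp_coprime cong_sym coprime_1_left)
  have neq: "(f ^^ k) (e 0) \<noteq> (f ^^ l) (e 0)" if "k < l" "l < p ^ n" for k l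
  proof
    assume "(f ^^ k) (e 0) = (f ^^ l) (e 0)"
    then have "int p ^ n dvd b * (\<Sum>i<l. a ^ i) - b * (\<Sum>i<k. a ^ i)"
      unfolding fk e by (metis cong_iff_dvd_diff cong_sym)
    also have "(\<Sum>i<l. a ^ i) = (\<Sum>i<k. a ^ i) + a ^ k * (\<Sum>i<l - k. a ^ i)"
    proof -
      have "(\<Sum>i<k + m. a ^ i) = (\<Sum>i<k. a ^ i) + a ^ k * (\<Sum>i<m. a ^ i)" for m
        by (induction m) (auto simp: algebra_simps power_add)
      then show ?thesis using that(1) by (metis le_add_diff_inverse less_imp_le)
    qed
    finally have "int p ^ n dvd b * a ^ k * (\<Sum>i<l - k. a ^ i)"
      by (simp add: algebra_simps)
    moreover have "coprime (int p ^ n) (b * a ^ k)"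
    proof -
      have "coprime (int p) b" using b p(1) by (simp add: prime_imp_coprime)
      then show ?thesis using a0 by (simp add: coprime_commute)
    qed
    ultimately have "int p ^ n dvd (\<Sum>i<l - k. a ^ i)"
      by (simp add: coprime_dvd_mult_right_iff)
    then have "p ^ n dvd l - k"
      using prime_power_dvd_geometric_sum[OF p a] by blast
    then show False using that by (meson dvd_imp_le diff_le_self le_trans not_le zero_less_diff)
  qed
  have range: "range e = e ` {0..<int (p ^ n)}"
  proof (intro equalityI subsetI)
    fix y assume "y \<in> range e"
    then obtain i where "y = e i" by blast
    then have "y = e (i mod int p ^ n)" using e by simp
    then show "y \<in> e ` {0..<int (p ^ n)}" using p(1) by (simp add: prime_gt_0_nat)
  qed auto
  let ?F = "(\<lambda>k. (f ^^ k) (e 0)) ` {..<p ^ n}"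
  have "inj_on (\<lambda>k. (f ^^ k) (e 0)) {..<p ^ n}"
    using neq by (intro linorder_inj_onI) auto
  then have "card ?F = p ^ n" by (simp add: card_image)
  moreover have "card (range e) \<le> p ^ n"
    unfolding range by (rule order.trans[OF card_image_le]) (auto simp: nat_power_eq)
  moreover have "?F \<subseteq> range e" by (auto simp: fk)
  moreover have "finite (range e)" unfolding range by simp
  ultimately have "?F = range e" by (metis card_seteq)
  then have "e i \<in> ?F" by blast
  then show ?thesis by (auto simp: image_iff)
qed

section \<open>Maximal subgroups of groups of prime power order\<close>

text \<open>Orbit lengths are powers of \<open>p\<close>. Were \<open>x\<close> the only fixed
  point, they would add up to \<open>1\<close> modulo \<open>p\<close>, against
  \<open>p dvd card E\<close>.\<close>

lemma (in group_action) prime_power_group_second_fixed_point: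
  assumes p: "Factorial_Ring.prime p" and order: "order G = p ^ n" and E: "finite E" "p dvd card E"
    and x: "x \<in> E" "\<And>g. g \<in> carrier G \<Longrightarrow> \<phi> g x = x"
  obtains y where "y \<in> E" "y \<noteq> x" "\<And>g. g \<in> carrier G \<Longrightarrow> \<phi> g y = y"
proof -
  have "\<exists>y \<in> E. y \<noteq> x \<and> (\<forall>g \<in> carrier G. \<phi> g y = y)"
  proof (rule ccontr)
    assume contr: "\<not> ?thesis"
    have orbit_x: "orbit G \<phi> x = {x}"
    proof
      show "orbit G \<phi> x \<subseteq> {x}" using x(2) by (auto simp: orbit_def)
      show "{x} \<subseteq> orbit G \<phi> x" using orbit_refl[OF x(1)] by simp
    qed
    have "p dvd card orb" if orb: "orb \<in> orbits G E \<phi> - {{x}}" for orb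
    proof -
      obtain y where y: "y \<in> E" "orb = orbit G \<phi> y" using orb by (auto simp: orbits_def)
      have "card orb dvd p ^ n"
        using orbit_stabilizer_theorem[OF y(1)] y(2) order by (metis dvd_triv_left)
      then obtain i where i: "card orb = p ^ i"
        using p by (metis divides_primepow_nat)
      have "i \<noteq> 0"
      proof
        assume "i = 0"
        then have "card orb = 1" using i by simp
        then obtain z where "orb = {z}" by (metis card_1_singletonE)
        moreover have "y \<in> orb" using orbit_refl y by simp
        ultimately have orb_y: "orb = {y}" by simp
        then have "\<phi> g y = y" if "g \<in> carrier G" for g
          using that y(2) by (auto simp: orbit_def)
        then have "y = x" using contr y(1) by blast
        then show False using orb orb_y by simp
      qed
      then show ?thesis using i by simp
    qed
    then have "p dvd (\<Sum>orb \<in> orbits G E \<phi> - {{x}}. card orb)"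
      by (rule dvd_sum)
    moreover have "card E = (\<Sum>orb \<in> orbits G E \<phi>. card orb)"
      using disjoint_sum[OF E(1), of "\<lambda>_. 1 :: nat"] by simp
    moreover have "(\<Sum>orb \<in> orbits G E \<phi>. card orb) = 1 + (\<Sum>orb \<in> orbits G E \<phi> - {{x}}. card orb)"
    proof -
      have "orbits G E \<phi> = orbit G \<phi> ` E" by (auto simp: orbits_def)
      then have "finite (orbits G E \<phi>)" "{x} \<in> orbits G E \<phi>"
        using E(1) x(1) orbit_x by auto
      then show ?thesis by (simp add: sum.remove[of _ "{x}"])
    qed
    ultimately have "p dvd 1"
      using E(2) by (metis dvd_add_left_iff)
    then show False using p by simp
  qed
  then show thesis using that by blast
qed

text \<open>Serves twice: for a group of prime power order and for the Galois group. Restricting to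
  \<open>lcosets H\<close> makes the maps extensional, as membership in \<open>Bij\<close>
  demands.\<close>

lemma (in group) left_coset_action:
  assumes H: "subgroup H G"
  shows "transitive_action G (lcosets H) (\<lambda>g. \<lambda>C \<in> lcosets H. g <# C)"
proof -
  have sub: "C \<subseteq> carrier G" if "C \<in> lcosets H" for C
    using subgroup.lcosets_carrier[OF H is_group that] .
  have closed: "g <# C \<in> lcosets H" if "g \<in> carrier G" "C \<in> lcosets H" for g C
    using that H by (auto simp: LCOSETS_def lcos_m_assoc subgroup.subset)
  have inv: "inv g <# (g <# C) = C" "g <# (inv g <# C) = C" if "g \<in> carrier G" "C \<in> lcosets H" for g C
    using that by (simp_all add: lcos_m_assoc sub lcos_mult_one)
  have Bij: "(\<lambda>C \<in> lcosets H. g <# C) \<in> Bij (lcosets H)" if "g \<in> carrier G" for g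
  proof -
    have "bij_betw (\<lambda>C \<in> lcosets H. g <# C) (lcosets H) (lcosets H)"
      by (rule bij_betwI[where g = "\<lambda>C. inv g <# C"]) (use that in \<open>auto simp: closed inv\<close>)
    then show ?thesis by (simp add: Bij_def)
  qed
  have "group_hom G (BijGroup (lcosets H)) (\<lambda>g. \<lambda>C \<in> lcosets H. g <# C)"
    unfolding group_hom_def group_hom_axioms_def
  proof (intro conjI is_group group_BijGroup homI)
    fix g assume "g \<in> carrier G"
    then show "(\<lambda>C \<in> lcosets H. g <# C) \<in> carrier (BijGroup (lcosets H))"
      using Bij by (simp add: BijGroup_def)
  next
    fix g h assume gh: "g \<in> carrier G" "h \<in> carrier G"
    have "(\<lambda>C \<in> lcosets H. (g \<otimes> h) <# C) =
      compose (lcosets H) (\<lambda>C \<in> lcosets H. g <# C) (\<lambda>C \<in> lcosets H. h <# C)"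
      using gh by (auto simp: compose_def restrict_def closed lcos_m_assoc sub intro!: ext)
    then show "(\<lambda>C \<in> lcosets H. (g \<otimes> h) <# C) =
      (\<lambda>C \<in> lcosets H. g <# C) \<otimes>\<^bsub>BijGroup (lcosets H)\<^esub> (\<lambda>C \<in> lcosets H. h <# C)"
      using Bij gh by (simp add: BijGroup_def)
  qed
  moreover have "\<exists>g \<in> carrier G. (\<lambda>C \<in> lcosets H. g <# C) C = D"
    if CD: "C \<in> lcosets H" "D \<in> lcosets H" for C D
  proof -
    obtain a b where ab: "a \<in> carrier G" "C = a <# H" "b \<in> carrier G" "D = b <# H"
      using CD by (auto simp: LCOSETS_def)
    then have "(b \<otimes> inv a) <# C = D"
      using H by (simp add: lcos_m_assoc m_assoc subgroup.subset)
    then show ?thesis using ab CD by (intro bexI[of _ "b \<otimes> inv a"]) auto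
  qed
  ultimately show ?thesis
    by (simp add: transitive_action_def transitive_action_axioms_def group_action_def)
qed

text \<open>\<open>H\<close> acts on its own left cosets and fixes the coset \<open>H\<close>. Their
  number is a positive power of \<open>p\<close>, so a second coset \<open>y <# H\<close> is fixed
  as well, which says that \<open>inv y\<close> conjugates \<open>H\<close> into itself.\<close>

lemma (in group) prime_power_group_normalizer_grows:
  assumes p: "Factorial_Ring.prime p" and order: "order G = p ^ n"
    and H: "subgroup H G" and proper: "H \<noteq> carrier G"
  obtains y where "y \<in> carrier G" "y \<notin> H" "\<And>h. h \<in> H \<Longrightarrow> y \<otimes> h \<otimes> inv y \<in> H"
proof -
  have fin: "finite (carrier G)"
    using order p by (metis order_gt_0_iff_finite prime_gt_0_nat zero_less_power)
  interpret transitive_action G "lcosets H" "\<lambda>g. \<lambda>C \<in> lcosets H. g <# C"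
    using left_coset_action[OF H] .
  interpret H: group_action "G\<lparr>carrier := H\<rparr>" "lcosets H" "\<lambda>g. \<lambda>C \<in> lcosets H. g <# C"
    using induced_action[OF H] .
  have HG: "H \<subseteq> carrier G" using H by (rule subgroup.subset)
  have H_dvd: "card H dvd p ^ n"
    using l_lagrange[OF fin H] order by (metis dvd_triv_right)
  then obtain i where i: "card H = p ^ i"
    using p by (metis divides_primepow_nat)
  have mult: "card (lcosets H) * card H = p ^ n"
    using l_lagrange[OF fin H] order by simp
  then obtain j where j: "card (lcosets H) = p ^ j"
    using p by (metis divides_primepow_nat dvd_triv_left)
  have "j \<noteq> 0"
  proof
    assume "j = 0"
    then have "card H = card (carrier G)" using mult j order by (simp add: order_def)
    then show False using proper HG fin by (metis card_subset_eq)
  qed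
  then have dvd: "p dvd card (lcosets H)" using j by simp
  have fixed: "h <# H = H" if "h \<in> H" for h
    using coset_join3[OF _ H that] that HG by blast
  have H_coset: "H \<in> lcosets H"
    using lcos_mult_one[OF HG] by (force simp: LCOSETS_def)
  obtain C where C: "C \<in> lcosets H" "C \<noteq> H"
    and C_fixed: "\<And>h. h \<in> carrier (G\<lparr>carrier := H\<rparr>) \<Longrightarrow> (\<lambda>C \<in> lcosets H. h <# C) C = C"
  proof (rule H.prime_power_group_second_fixed_point[OF p])
    show "order (G\<lparr>carrier := H\<rparr>) = p ^ i" using i by (simp add: order_def)
    show "finite (lcosets H)" using fin by (simp add: LCOSETS_def)
    show "(\<lambda>C \<in> lcosets H. h <# C) H = H" if "h \<in> carrier (G\<lparr>carrier := H\<rparr>)" for h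
      using that fixed H_coset by simp
  qed (use dvd H_coset in auto)
  obtain y where y: "y \<in> carrier G" "C = y <# H" using C(1) by (auto simp: LCOSETS_def)
  have "inv y \<otimes> h \<otimes> inv (inv y) \<in> H" if h: "h \<in> H" for h
  proof -
    have "h \<otimes> y \<in> y <# H"
    proof -
      have "y \<in> y <# H" using y(1) H by (rule lcos_self)
      then have "h \<otimes> y \<in> h <# (y <# H)"
        unfolding l_coset_def by blast
      then show ?thesis using C_fixed[of h] h C(1) y(2) by simp
    qed
    then have "inv y \<otimes> (h \<otimes> y) \<in> H"
      by (rule subgroup.lcos_module_imp[OF H is_group y(1)])
    moreover have "h \<in> carrier G" using h HG by blast
    ultimately show ?thesis using y(1) by (simp add: m_assoc)
  qed
  moreover have "inv y \<notin> H"
  proof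
    assume "inv y \<in> H"
    then have "y \<in> H" using subgroup.m_inv_closed[OF H, of "inv y"] y(1) by simp
    then show False using fixed C(2) y(2) by simp
  qed
  ultimately show thesis using that[OF inv_closed[OF y(1)]] by blast
qed

lemma (in group) subgroup_r_coset_vimage:
  assumes "H \<lhd> G" and "subgroup K (G Mod H)"
  shows "subgroup {x \<in> carrier G. H #> x \<in> K} G"
proof -
  interpret H: normal H G by fact
  interpret Q: group "G Mod H" by (rule H.factorgroup_is_group)
  interpret q: group_hom G "G Mod H" "\<lambda>x. H #> x"
    using H.r_coset_hom_Mod by unfold_locales
  show ?thesis
  proof (rule subgroupI)
    have "H #> \<one> \<in> K"
      using q.hom_one subgroup.one_closed[OF assms(2)] by simp
    then show "{x \<in> carrier G. H #> x \<in> K} \<noteq> {}" by blast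
  next
    fix x assume "x \<in> {x \<in> carrier G. H #> x \<in> K}"
    then show "inv x \<in> {x \<in> carrier G. H #> x \<in> K}"
      using q.hom_inv[of x] subgroup.m_inv_closed[OF assms(2), of "H #> x"] by simp
  next
    fix x y assume "x \<in> {x \<in> carrier G. H #> x \<in> K}" "y \<in> {x \<in> carrier G. H #> x \<in> K}"
    then show "x \<otimes> y \<in> {x \<in> carrier G. H #> x \<in> K}"
      using q.hom_mult[of x y] subgroup.m_closed[OF assms(2), of "H #> x" "H #> y"] by simp
  qed auto
qed

text \<open>The normalizer of \<open>H\<close> is strictly larger than \<open>H\<close>, so by
  maximality it is the whole group.\<close>

lemma (in group) maximal_subgroup_prime_power_group_normal:
  assumes p: "Factorial_Ring.prime p" and order: "order G = p ^ n"
    and H: "subgroup H G" and proper: "H \<noteq> carrier G"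
    and maximal: "\<And>K. subgroup K G \<Longrightarrow> H \<subseteq> K \<Longrightarrow> K = H \<or> K = carrier G"
  shows "H \<lhd> G"
proof -
  have fin: "finite (carrier G)"
    using order p by (metis order_gt_0_iff_finite prime_gt_0_nat zero_less_power)
  have HG: "H \<subseteq> carrier G" using H by (rule subgroup.subset)
  obtain y where y: "y \<in> carrier G" "y \<notin> H" "\<And>h. h \<in> H \<Longrightarrow> y \<otimes> h \<otimes> inv y \<in> H"
    using prime_power_group_normalizer_grows[OF p order H proper] by blast
  \<comment> \<open>Equality in place of inclusion makes \<open>K\<close> closed under inverses. As
    \<open>H\<close> is finite, inclusion still suffices for membership, which is shown
    next.\<close>
  define K where "K = {z \<in> carrier G. (\<lambda>h. z \<otimes> h \<otimes> inv z) ` H = H}"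
  have K: "z \<in> K" if z: "z \<in> carrier G" "\<And>h. h \<in> H \<Longrightarrow> z \<otimes> h \<otimes> inv z \<in> H" for z
  proof -
    have "inj_on (\<lambda>h. z \<otimes> h \<otimes> inv z) H"
      using z HG by (intro inj_onI) (auto simp: subset_iff)
    moreover have "(\<lambda>h. z \<otimes> h \<otimes> inv z) ` H \<subseteq> H" using z(2) by blast
    moreover have "finite H" using HG fin by (rule finite_subset)
    ultimately have "(\<lambda>h. z \<otimes> h \<otimes> inv z) ` H = H" by (simp add: endo_inj_surj)
    then show ?thesis using z(1) by (simp add: K_def)
  qed
  have KD: "z \<otimes> h \<otimes> inv z \<in> H" if "z \<in> K" "h \<in> H" for z h
    using that unfolding K_def by blast
  have "subgroup K G"
  proof (rule subgroupI)
    show "K \<noteq> {}" using K[OF y(1,3)] by blast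
  next
    fix z assume z: "z \<in> K"
    then have zG: "z \<in> carrier G" by (simp add: K_def)
    show "inv z \<in> K"
    proof (rule K)
      fix h assume "h \<in> H"
      then have "h \<in> (\<lambda>h. z \<otimes> h \<otimes> inv z) ` H" using z by (simp add: K_def)
      then obtain h' where h': "h' \<in> H" "h = z \<otimes> h' \<otimes> inv z" by blast
      then have "h' \<in> carrier G" using HG by blast
      then have "inv z \<otimes> h \<otimes> inv (inv z) = h'"
        using h' zG by (simp add: m_assoc inv_solve_left')
      then show "inv z \<otimes> h \<otimes> inv (inv z) \<in> H" using h' by simp
    qed (use zG in simp)
  next
    fix w z assume wz: "w \<in> K" "z \<in> K"
    then have wzG: "w \<in> carrier G" "z \<in> carrier G" by (simp_all add: K_def)
    show "w \<otimes> z \<in> K"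
    proof (rule K)
      fix h assume h: "h \<in> H"
      then have "w \<otimes> (z \<otimes> h \<otimes> inv z) \<otimes> inv w \<in> H" using wz KD by blast
      moreover have "h \<in> carrier G" using h HG by blast
      ultimately show "w \<otimes> z \<otimes> h \<otimes> inv (w \<otimes> z) \<in> H"
        using wzG by (simp add: m_assoc inv_mult_group)
    qed (use wzG in simp)
  qed (auto simp: K_def)
  moreover have "H \<subseteq> K"
    using HG by (auto intro!: K subgroup.m_closed[OF H] subgroup.m_inv_closed[OF H])
  moreover have "K \<noteq> H" using K[OF y(1,3)] y(2) by blast
  ultimately have "K = carrier G" using maximal by blast
  then show ?thesis
    using KD H by (simp add: normal_inv_iff)
qed

text \<open>By maximality the preimage of the cyclic subgroup generated by a nontrivial coset is the
  whole group, so every nontrivial coset generates the quotient by \<open>H\<close>. Hence the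
  quotient is abelian, and it has exponent \<open>p\<close>.\<close>

lemma (in group) maximal_subgroup_prime_power_group:
  assumes p: "Factorial_Ring.prime p" and order: "order G = p ^ n"
    and H: "subgroup H G" and proper: "H \<noteq> carrier G"
    and maximal: "\<And>K. subgroup K G \<Longrightarrow> H \<subseteq> K \<Longrightarrow> K = H \<or> K = carrier G"
    and a: "a \<in> carrier G"
  shows "a [^] p \<in> H" and "b \<in> carrier G \<Longrightarrow> a \<otimes> b \<otimes> inv (b \<otimes> a) \<in> H"
proof -
  have normal: "H \<lhd> G"
    using maximal_subgroup_prime_power_group_normal[OF p order H proper maximal] .
  interpret H: normal H G by (rule normal)
  interpret Q: group "G Mod H" by (rule H.factorgroup_is_group)
  interpret q: group_hom G "G Mod H" "\<lambda>x. H #> x"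
    using H.r_coset_hom_Mod by unfold_locales
  have q_one: "H #> x = \<one>\<^bsub>G Mod H\<^esub> \<longleftrightarrow> x \<in> H" if "x \<in> carrier G" for x
    using that H by (metis coset_join1 coset_join2 one_FactGroup subgroup.subset)
  have gen: "\<exists>i::int. H #> x = (H #> y) [^]\<^bsub>G Mod H\<^esub> i"
    if y: "y \<in> carrier G" "y \<notin> H" and x: "x \<in> carrier G" for x y
  proof -
    let ?C = "generate (G Mod H) {H #> y}"
    have C: "subgroup ?C (G Mod H)" using y by (intro Q.generate_is_subgroup) auto
    let ?K = "{x \<in> carrier G. H #> x \<in> ?C}"
    have "subgroup ?K G" by (rule subgroup_r_coset_vimage[OF normal C])
    moreover have "H \<subseteq> ?K"
    proof
      fix h assume h: "h \<in> H"
      then have "H #> h = \<one>\<^bsub>G Mod H\<^esub>" using q_one H.subset by blast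
      then show "h \<in> ?K" using h subgroup.one_closed[OF C] H.subset by auto
    qed
    moreover have "y \<in> ?K" using y(1) by (simp add: generate.incl)
    ultimately have "?K = carrier G" using maximal y(2) by blast
    then have "H #> x \<in> ?C" using x by blast
    then show ?thesis using y(1) by (auto simp: Q.generate_pow)
  qed
  have comm: "a \<otimes> b \<otimes> inv (b \<otimes> a) \<in> H" if b: "b \<in> carrier G"
  proof -
    obtain y where y: "y \<in> carrier G" "y \<notin> H" using proper H.subset by blast
    obtain i j :: int where "H #> a = (H #> y) [^]\<^bsub>G Mod H\<^esub> i" "H #> b = (H #> y) [^]\<^bsub>G Mod H\<^esub> j"
      using gen[OF y a] gen[OF y b] by blast
    then have "(H #> a) \<otimes>\<^bsub>G Mod H\<^esub> (H #> b) = (H #> b) \<otimes>\<^bsub>G Mod H\<^esub> (H #> a)"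
      using y(1) by (metis Q.int_pow_mult add.commute q.hom_closed)
    then have "H #> (a \<otimes> b) = H #> (b \<otimes> a)"
      using a b by (metis q.hom_mult)
    then have "H #> (a \<otimes> b \<otimes> inv (b \<otimes> a)) = \<one>\<^bsub>G Mod H\<^esub>"
      using a b by (metis q.hom_mult q.hom_inv Q.r_inv q.hom_closed inv_closed m_closed)
    then show ?thesis by (rule q_one[THEN iffD1, rotated]) (use a b in simp)
  qed
  then show "b \<in> carrier G \<Longrightarrow> a \<otimes> b \<otimes> inv (b \<otimes> a) \<in> H" .
  show "a [^] p \<in> H"
  proof (rule ccontr)
    \<comment> \<open>The coset of \<open>a [^] p\<close> would generate, so the coset of
      \<open>a\<close> would equal its own power with exponent \<open>p * i\<close>. Its order
      divides both \<open>p * i - 1\<close> and \<open>p ^ n\<close>, hence is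
      \<open>1\<close>.\<close>
    assume not: "a [^] p \<notin> H"
    let ?A = "H #> a"
    have A: "?A \<in> carrier (G Mod H)" using a by simp
    obtain i :: int where "?A = (H #> (a [^] p)) [^]\<^bsub>G Mod H\<^esub> i"
      using gen[OF _ not a] a by auto
    also have "\<dots> = ?A [^]\<^bsub>G Mod H\<^esub> (int p * i)"
    proof -
      have "H #> (a [^] p) = ?A [^]\<^bsub>G Mod H\<^esub> int p"
        by (simp only: q.hom_nat_pow[OF a] int_pow_int)
      then show ?thesis using Q.int_pow_pow[OF A] by simp
    qed
    finally have "?A [^]\<^bsub>G Mod H\<^esub> (1::int) = ?A [^]\<^bsub>G Mod H\<^esub> (int p * i)"
      using A by simp
    then have dvd: "int (Q.ord ?A) dvd int p * i - 1"
      by (simp only: Q.int_pow_eq[OF A])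
    have "a [^] (p ^ n) = \<one>" using pow_order_eq_1[OF a] order by simp
    then have "?A [^]\<^bsub>G Mod H\<^esub> (p ^ n) = \<one>\<^bsub>G Mod H\<^esub>"
      using a by (metis q.hom_nat_pow q.hom_one)
    then have "Q.ord ?A dvd p ^ n" by (simp only: Q.pow_eq_id[OF A])
    then obtain k where k: "Q.ord ?A = p ^ k" using p by (metis divides_primepow_nat)
    have "k = 0"
    proof (rule ccontr)
      assume "k \<noteq> 0"
      then have "int p dvd int p * i - 1" using dvd k by (metis dvd_power dvd_trans neq0_conv of_nat_dvd_iff)
      then have "int p dvd 1" using dvd_diff_right_iff[of "int p" "int p * i" 1] by simp
      then show False using p by simp
    qed
    then have "?A = \<one>\<^bsub>G Mod H\<^esub>" using k A Q.ord_eq_1 by simp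
    then have "a \<in> H" using a q_one by simp
    then have "a [^] p \<in> H"
      using subgroup_int_pow_closed[OF H, of a "int p"] by (simp add: int_pow_int)
    then show False using not by simp
  qed
qed

text \<open>Burnside's basis theorem for one generator, with the Frattini subgroup written as the
  subgroup generated by commutators and \<open>p\<close>-th powers.\<close>

definition (in group) commutator_power_subgroup :: "nat \<Rightarrow> 'a set" where
  "commutator_power_subgroup p = generate G
    ({a \<otimes> b \<otimes> inv (b \<otimes> a) | a b. a \<in> carrier G \<and> b \<in> carrier G} \<union> {a [^] p | a. a \<in> carrier G})"

text \<open>If \<open>x\<close> did not generate, it would lie in a maximal subgroup
  \<open>H\<close>. That \<open>H\<close> contains all commutators and \<open>p\<close>-th powers,
  hence the translates of \<open>commutator_power_subgroup p\<close> by powers of \<open>x\<close>,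
  and these cover the group.\<close>

lemma (in group) generated_mod_commutator_power_subgroup:
  assumes p: "Factorial_Ring.prime p" and order: "order G = p ^ n" and x: "x \<in> carrier G"
    and gen: "\<And>y. y \<in> carrier G \<Longrightarrow> \<exists>i::nat. y \<in> commutator_power_subgroup p #> x [^] i"
  shows "generate G {x} = carrier G"
proof (rule ccontr)
  assume neq: "generate G {x} \<noteq> carrier G"
  have fin: "finite (carrier G)"
    using order p by (metis order_gt_0_iff_finite prime_gt_0_nat zero_less_power)
  define P where "P K \<longleftrightarrow> subgroup K G \<and> x \<in> K \<and> K \<noteq> carrier G" for K
  have "P (generate G {x})"
    using neq x by (auto simp: P_def generate.incl intro!: generate_is_subgroup)
  moreover have "finite {K. P K}"
    by (rule finite_subset[of _ "Pow (carrier G)"]) (use fin in \<open>auto simp: P_def dest: subgroup.subset\<close>)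
  ultimately obtain H where H: "P H" "\<And>K. P K \<Longrightarrow> H \<subseteq> K \<Longrightarrow> H = K"
    using finite_has_maximal[of "{K. P K}"] by blast
  have max: "K = H \<or> K = carrier G" if "subgroup K G" "H \<subseteq> K" for K
    using H that by (auto simp: P_def)
  have HG: "subgroup H G" "x \<in> H" "H \<noteq> carrier G" using H(1) by (simp_all add: P_def)
  have sub: "commutator_power_subgroup p \<subseteq> H"
    unfolding commutator_power_subgroup_def
    by (rule generate_subgroup_incl[OF _ HG(1)])
       (use maximal_subgroup_prime_power_group[OF p order HG(1,3) max] in blast)
  have "y \<in> H" if y: "y \<in> carrier G" for y
  proof -
    obtain i :: nat and m where "m \<in> commutator_power_subgroup p" "y = m \<otimes> x [^] i"
      using gen[OF y] unfolding r_coset_def by blast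
    then show ?thesis
      using sub HG subgroup_int_pow_closed[of H x "int i"]
      by (auto simp: int_pow_int intro: subgroup.m_closed)
  qed
  then show False using HG(3) subgroup.subset[OF HG(1)] by blast
qed

text \<open>A conjugate of \<open>h\<close> is a commutator times \<open>h\<close>, and commutators
  are among the generators.\<close>

lemma (in group) commutator_power_subgroup_normal: "commutator_power_subgroup p \<lhd> G"
proof -
  let ?A = "{a \<otimes> b \<otimes> inv (b \<otimes> a) | a b. a \<in> carrier G \<and> b \<in> carrier G} \<union> {a [^] p | a. a \<in> carrier G}"
  have A: "?A \<subseteq> carrier G" by auto
  have M: "subgroup (commutator_power_subgroup p) G"
    unfolding commutator_power_subgroup_def using A by (rule generate_is_subgroup)
  show ?thesis
    unfolding normal_inv_iff
  proof (intro conjI M ballI)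
    fix x h assume x: "x \<in> carrier G" and h: "h \<in> commutator_power_subgroup p"
    then have hG: "h \<in> carrier G" using subgroup.subset[OF M] by blast
    then have "x \<otimes> h \<otimes> inv (h \<otimes> x) \<in> commutator_power_subgroup p"
      using x unfolding commutator_power_subgroup_def by (intro generate.incl) blast
    then have "x \<otimes> h \<otimes> inv (h \<otimes> x) \<otimes> h \<in> commutator_power_subgroup p"
      using h M by (simp add: subgroup.m_closed)
    then show "x \<otimes> h \<otimes> inv x \<in> commutator_power_subgroup p"
      using x hG by (simp add: inv_mult_group m_assoc)
  qed
qed

text \<open>Homomorphisms preserve commutators and \<open>p\<close>-th powers. For an endomorphism
  this gives the induced map on the quotient.\<close>

lemma (in group_hom) commutator_power_subgroup_image:
  "h ` G.commutator_power_subgroup p \<subseteq> H.commutator_power_subgroup p"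
proof -
  let ?A = "{a \<otimes> b \<otimes> inv (b \<otimes> a) | a b. a \<in> carrier G \<and> b \<in> carrier G} \<union> {a [^] p | a. a \<in> carrier G}"
  have A: "?A \<subseteq> carrier G" by auto
  have "h ` G.commutator_power_subgroup p = generate H (h ` ?A)"
    unfolding G.commutator_power_subgroup_def using generate_img[OF A] by (rule sym)
  also have "\<dots> \<subseteq> H.commutator_power_subgroup p"
    unfolding H.commutator_power_subgroup_def
  proof (rule H.mono_generate, intro subsetI)
    fix y assume "y \<in> h ` ?A"
    then consider a b where "a \<in> carrier G" "b \<in> carrier G" "y = h (a \<otimes> b \<otimes> inv (b \<otimes> a))"
      | a where "a \<in> carrier G" "y = h (a [^] p)" by blast
    then show "y \<in> {a \<otimes>\<^bsub>H\<^esub> b \<otimes>\<^bsub>H\<^esub> inv\<^bsub>H\<^esub> (b \<otimes>\<^bsub>H\<^esub> a) | a b. a \<in> carrier H \<and> b \<in> carrier H} \<union>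
        {a [^]\<^bsub>H\<^esub> p | a. a \<in> carrier H}"
    proof cases
      case (1 a b)
      then have "y = h a \<otimes>\<^bsub>H\<^esub> h b \<otimes>\<^bsub>H\<^esub> inv\<^bsub>H\<^esub> (h b \<otimes>\<^bsub>H\<^esub> h a)" by simp
      moreover have "h a \<in> carrier H" "h b \<in> carrier H" using 1 by simp_all
      ultimately show ?thesis by blast
    next
      case (2 a)
      then have "y = h a [^]\<^bsub>H\<^esub> p" by (simp add: hom_nat_pow)
      moreover have "h a \<in> carrier H" using 2 by simp
      ultimately show ?thesis by blast
    qed
  qed
  finally show ?thesis .
qed

section \<open>Affine cycles on groups of prime power order\<close>

text \<open>Additively the map is \<open>\<theta> - 1\<close>; commutativity makes this difference
  of endomorphisms additive.\<close>

lemma (in comm_group) displacement_hom: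
  assumes "\<theta> \<in> hom G G"
  shows "(\<lambda>x. \<theta> x \<otimes> inv x) \<in> hom G G"
proof (rule homI)
  interpret \<theta>: group_hom G G \<theta>
    using assms by (simp add: group_hom_def group_hom_axioms_def)
  show "\<theta> x \<otimes> inv x \<in> carrier G" if "x \<in> carrier G" for x using that by simp
  show "\<theta> (x \<otimes> y) \<otimes> inv (x \<otimes> y) = (\<theta> x \<otimes> inv x) \<otimes> (\<theta> y \<otimes> inv y)"
    if "x \<in> carrier G" "y \<in> carrier G" for x y
    using that by (simp add: inv_mult m_ac)
qed

lemma (in group) nat_pow_mod_exponent:
  assumes "x \<in> carrier G" "x [^] (q::nat) = \<one>"
  shows "x [^] (k mod q) = x [^] k"
proof -
  have "x [^] k = x [^] (q * (k div q) + k mod q)" by simp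
  also have "\<dots> = (x [^] q) [^] (k div q) \<otimes> x [^] (k mod q)"
    using assms(1) by (simp add: nat_pow_mult nat_pow_pow)
  finally show ?thesis using assms by simp
qed

text \<open>Replacing \<open>k\<close> by \<open>k + q\<close> adds
  \<open>q * k + (q choose 2)\<close>, and for odd \<open>q\<close> the number
  \<open>q choose 2\<close> is a multiple of \<open>q\<close>.\<close>

lemma choose_two_mod_odd:
  assumes "odd q"
  shows "(k mod q choose 2) mod q = (k choose 2) mod q"
proof -
  have add: "(k + m) choose 2 = (k choose 2) + k * m + (m choose 2)" for k m :: nat
  proof (induction m)
    case (Suc m)
    have "Suc l choose 2 = l + (l choose 2)" for l by (simp add: numeral_2_eq_2)
    then show ?case using Suc by simp
  qed simp
  have "[(r + q * i) choose 2 = r choose 2] (mod q)" for r i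
  proof (induction i)
    case (Suc i)
    obtain s where "q = Suc (2 * s)" using assms by (metis oddE Suc_eq_plus1)
    then have "q choose 2 = q * s" by (simp add: choose_two)
    then have "(r + q * Suc i) choose 2 = ((r + q * i) choose 2) + q * (r + q * i + s)"
      using add[of "r + q * i" q] by (simp add: algebra_simps)
    then show ?case using Suc by (simp add: cong_def)
  qed simp
  from this[of "k mod q" "k div q"] show ?thesis by (simp add: cong_def)
qed

context comm_group
begin

context
  fixes p m :: nat and \<theta> :: "'a \<Rightarrow> 'a" and g :: 'a and c :: "nat \<Rightarrow> 'a"
  assumes p: "Factorial_Ring.prime p" "odd p" and order: "order G = p ^ m"
    and exponent: "\<And>x. x \<in> carrier G \<Longrightarrow> x [^] p = \<one>"
    and \<theta>: "\<theta> \<in> hom G G" "\<theta> ` carrier G = carrier G"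
    and g: "g \<in> carrier G"
    and c: "c 0 = \<one>" "\<And>k. c (Suc k) = \<theta> (c k) \<otimes> g" "range c = carrier G"
begin

private definition \<delta> where "\<delta> x = \<theta> x \<otimes> inv x"

private lemma \<delta>: "group_hom G G \<delta>"
  using displacement_hom[OF \<theta>(1)] unfolding \<delta>_def group_hom_def group_hom_axioms_def by auto

interpretation \<theta>: group_hom G G \<theta>
  using \<theta>(1) by (simp add: group_hom_def group_hom_axioms_def)

interpretation \<delta>: group_hom G G \<delta> by (rule \<delta>)

private lemma \<theta>_eq: "x \<in> carrier G \<Longrightarrow> \<theta> x = \<delta> x \<otimes> x"
  by (simp add: \<delta>_def m_assoc)

text \<open>Binomial expansion, in powers of \<open>\<delta>\<close>, of the iteration of
  \<open>x \<mapsto> \<theta> x \<otimes> g\<close> started at \<open>\<one>\<close>. The terms of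
  order two and higher are gathered in \<open>\<delta> (\<delta> h)\<close>.\<close>

private lemma orbit_mod_second_displacement:
  "\<exists>h \<in> carrier G. c k = \<delta> (\<delta> h) \<otimes> (g [^] k \<otimes> \<delta> g [^] (k choose 2))"
proof (induction k)
  case 0
  show ?case by (intro bexI[of _ \<one>]) (simp_all add: c numeral_2_eq_2)
next
  case (Suc k)
  then obtain h where h: "h \<in> carrier G" "c k = \<delta> (\<delta> h) \<otimes> (g [^] k \<otimes> \<delta> g [^] (k choose 2))"
    by blast
  let ?b = "k choose 2"
  \<comment> \<open>Applying \<open>\<delta>\<close> to the formula for \<open>c k\<close> creates
    \<open>\<delta> (\<delta> (\<delta> h))\<close> and a power of
    \<open>\<delta> (\<delta> g)\<close>. The new witness absorbs both, and the factor
    \<open>\<delta> g [^] k\<close> raises the exponent to \<open>Suc k choose 2\<close>.\<close>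
  let ?h = "h \<otimes> (\<delta> h \<otimes> g [^] ?b)"
  have choose: "Suc k choose 2 = ?b + k" by (simp add: numeral_2_eq_2)
  have ck: "c k \<in> carrier G" using c(3) by blast
  have "c (Suc k) = \<delta> (c k) \<otimes> c k \<otimes> g" using c(2) \<theta>_eq[OF ck] by simp
  also have "\<dots> = \<delta> (\<delta> ?h) \<otimes> (g [^] Suc k \<otimes> \<delta> g [^] (Suc k choose 2))"
    unfolding h(2) choose
    using h(1) g by (simp add: \<delta>.hom_mult \<delta>.hom_nat_pow nat_pow_mult[symmetric] m_ac)
  finally show ?case using h(1) g by (intro bexI[of _ ?h]) auto
qed

text \<open>A count of cosets. Modulo the image of the square of \<open>\<delta>\<close> the cycle
  takes at most \<open>p\<close> values, so that image has index at most \<open>p\<close>. If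
  \<open>\<delta>\<close> is not onto, its image has index at least \<open>p\<close>; as it contains
  the smaller image, the two agree.\<close>

private lemma second_displacement_image: "\<delta> ` \<delta> ` carrier G = \<delta> ` carrier G"
proof (cases "\<delta> ` carrier G = carrier G")
  case False
  let ?D1 = "\<delta> ` carrier G" and ?D2 = "\<delta> ` \<delta> ` carrier G"
  have fin: "finite (carrier G)"
    using order p(1) by (metis order_gt_0_iff_finite prime_gt_0_nat zero_less_power)
  have D1: "subgroup ?D1 G" by (rule \<delta>.img_is_subgroup)
  have D2: "subgroup ?D2 G" using \<delta>.subgroup_img_is_subgroup[OF D1] .
  define t where "t k = g [^] k \<otimes> \<delta> g [^] (k choose 2)" for k :: nat
  have t: "t k \<in> carrier G" for k using g by (simp add: t_def)
  have t_mod: "t (k mod p) = t k" for k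
  proof -
    have "\<delta> g [^] (k mod p choose 2) = \<delta> g [^] (k choose 2)"
      using nat_pow_mod_exponent[OF \<delta>.hom_closed[OF g] exponent[OF \<delta>.hom_closed[OF g]]]
        choose_two_mod_odd[OF p(2)] by metis
    then show ?thesis
      using nat_pow_mod_exponent[OF g exponent[OF g]] by (simp add: t_def)
  qed
  have "carrier G \<subseteq> (\<Union>r<p. ?D2 #> t r)"
  proof
    fix x assume "x \<in> carrier G"
    then obtain k where "x = c k" using c(3) by blast
    then obtain h where "h \<in> carrier G" "x = \<delta> (\<delta> h) \<otimes> t (k mod p)"
      using orbit_mod_second_displacement[of k] unfolding t_def[symmetric] t_mod by blast
    moreover have "k mod p < p" using p(1) by (simp add: prime_gt_0_nat)
    ultimately show "x \<in> (\<Union>r<p. ?D2 #> t r)" by (auto simp: r_coset_def)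
  qed
  then have "card (carrier G) \<le> card (\<Union>r<p. ?D2 #> t r)"
    by (rule card_mono[rotated])
       (use fin D2 t in \<open>auto intro!: finite_subset[OF r_coset_subset_G fin] dest: subgroup.subset\<close>)
  also have "\<dots> \<le> (\<Sum>r<p. card (?D2 #> t r))" by (rule card_UN_le) simp
  also have "\<dots> \<le> (\<Sum>r<p. card ?D2)"
  proof (rule sum_mono)
    fix r
    have "?D2 #> t r = (\<lambda>x. x \<otimes> t r) ` ?D2" by (auto simp: r_coset_def)
    then show "card (?D2 #> t r) \<le> card ?D2" using fin by (simp add: card_image_le)
  qed
  finally have le: "card (carrier G) \<le> p * card ?D2" by simp
  have lagr: "card (rcosets ?D1) * card ?D1 = p ^ m"
    using lagrange[OF D1] order by simp
  then obtain j where j: "card (rcosets ?D1) = p ^ j"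
    using p(1) by (metis divides_primepow_nat dvd_triv_left)
  have "j \<noteq> 0"
  proof
    assume "j = 0"
    then have "card ?D1 = card (carrier G)" using lagr j order by (simp add: order_def)
    then show False using card_subset_eq[OF fin subgroup.subset[OF D1]] False by simp
  qed
  then have "p \<le> card (rcosets ?D1)" using j p(1)
    by (simp add: prime_gt_0_nat self_le_power Suc_leI)
  then have "p * card ?D1 \<le> p ^ m"
    unfolding lagr[symmetric] by (rule mult_le_mono1)
  then have "p * card ?D1 \<le> p * card ?D2"
    using le order unfolding order_def by linarith
  then have "card ?D1 \<le> card ?D2" using p(1) by (simp add: prime_gt_0_nat)
  moreover have "?D2 \<subseteq> ?D1" by auto
  ultimately show ?thesis
    using fin by (intro card_seteq) auto
qed simp

text \<open>Choosing \<open>i\<close> with \<open>\<delta> g = \<delta> (\<delta> i)\<close> makes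
  \<open>k = g \<otimes> inv (\<delta> i)\<close> a fixed point of \<open>\<theta>\<close>.
  Translation by \<open>i\<close> turns \<open>x \<mapsto> \<theta> x \<otimes> g\<close> into
  \<open>x \<mapsto> \<theta> x \<otimes> k\<close>, and the orbit of \<open>\<one>\<close> under
  the latter consists of the powers of \<open>k\<close>.\<close>

lemma elementary_abelian_affine_cycle_imp_cyclic:
  "\<exists>k \<in> carrier G. \<forall>y \<in> carrier G. \<exists>j::nat. y = k [^] j"
proof -
  have "\<delta> g \<in> \<delta> ` \<delta> ` carrier G"
    unfolding second_displacement_image using g by blast
  then obtain i where i: "i \<in> carrier G" "\<delta> g = \<delta> (\<delta> i)" by blast
  define k where "k = g \<otimes> inv (\<delta> i)"
  have k: "k \<in> carrier G" using i g by (simp add: k_def)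
  have "\<delta> k = \<one>" using i g by (simp add: k_def \<delta>.hom_mult)
  then have \<theta>k: "\<theta> k = k" using \<theta>_eq[OF k] k by simp
  have g_eq: "g = k \<otimes> (\<theta> i \<otimes> inv i)"
    using i g by (simp add: k_def \<delta>_def[symmetric] m_assoc)
  \<comment> \<open>The translated cycle is to start at \<open>\<one>\<close>, so the original one
    is read from the index \<open>l\<close> where it meets \<open>inv i\<close>.\<close>
  obtain l where l: "inv i = c l" using c(3) i(1) by (metis imageE inv_closed)
  have swap: "a \<otimes> u \<otimes> (k \<otimes> (t \<otimes> x)) = a \<otimes> k \<otimes> x \<otimes> (t \<otimes> u)"
    if "a \<in> carrier G" "u \<in> carrier G" "t \<in> carrier G" "x \<in> carrier G" for a u t x
    using that k by (simp add: m_ac)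
  have c_l: "c (l + j) = k [^] j \<otimes> inv i" for j
  proof (induction j)
    case (Suc j)
    have "c (l + Suc j) = \<theta> (k [^] j \<otimes> inv i) \<otimes> g" using Suc c(2) by simp
    also have "\<dots> = k [^] j \<otimes> inv (\<theta> i) \<otimes> (k \<otimes> (\<theta> i \<otimes> inv i))"
      using k i(1) g_eq by (simp add: \<theta>.hom_nat_pow \<theta>k)
    also have "\<dots> = k [^] Suc j \<otimes> inv i \<otimes> (\<theta> i \<otimes> inv (\<theta> i))"
      using k i(1) by (subst swap) auto
    finally show ?case using k i(1) by simp
  qed (use i(1) in \<open>simp add: l[symmetric]\<close>)
  \<comment> \<open>Only the indices from \<open>l\<close> on are described by \<open>c_l\<close>.
    Every tail of \<open>c\<close> still covers the group, because
    \<open>x \<mapsto> \<theta> x \<otimes> g\<close> is onto.\<close>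
  have onto: "\<exists>j. y = c (n + j)" if "y \<in> carrier G" for y n
    using that
  proof (induction n arbitrary: y)
    case 0
    then show ?case using c(3) by auto
  next
    case (Suc n)
    then have "y \<otimes> inv g \<in> \<theta> ` carrier G" using \<theta>(2) g by simp
    then obtain x where x: "x \<in> carrier G" "y \<otimes> inv g = \<theta> x" by blast
    then have "y = \<theta> x \<otimes> g" using Suc.prems g by (metis inv_solve_right' \<theta>.hom_closed)
    moreover obtain j where "x = c (n + j)" using Suc.IH[OF x(1)] by blast
    ultimately have "y = c (Suc n + j)" using c(2) by simp
    then show ?case by blast
  qed
  have "\<exists>j::nat. y = k [^] j" if y: "y \<in> carrier G" for y
  proof -
    obtain j :: nat where "y \<otimes> inv i = k [^] j \<otimes> inv i"
      using onto[of "y \<otimes> inv i" l] m_closed[OF y inv_closed[OF i(1)]] unfolding c_l by blast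
    then have "y = k [^] j" using y i(1) k by simp
    then show ?thesis ..
  qed
  then show ?thesis using k by blast
qed

end

end

text \<open>Modulo \<open>commutator_power_subgroup p\<close> the group becomes abelian of exponent
  \<open>p\<close>, and \<open>\<theta>\<close> and the cycle descend. A generator of the quotient
  lifts to a generator by the basis theorem.\<close>

lemma (in group) prime_power_group_affine_cycle_imp_cyclic:
  assumes p: "Factorial_Ring.prime p" "odd p" and order: "order G = p ^ n"
    and \<theta>: "\<theta> \<in> hom G G" "\<theta> ` carrier G = carrier G" and g: "g \<in> carrier G"
    and c: "c 0 = \<one>" "\<And>k. c (Suc k) = \<theta> (c k) \<otimes> g" "range c = carrier G"
  shows "\<exists>x \<in> carrier G. generate G {x} = carrier G"
proof -
  define M where "M = commutator_power_subgroup p"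
  let ?A = "{a \<otimes> b \<otimes> inv (b \<otimes> a) | a b. a \<in> carrier G \<and> b \<in> carrier G} \<union> {a [^] p | a. a \<in> carrier G}"
  have MA: "?A \<subseteq> M"
    unfolding M_def commutator_power_subgroup_def by (rule generate.incl[THEN subsetI])
  have normal: "M \<lhd> G" unfolding M_def by (rule commutator_power_subgroup_normal)
  interpret M: normal M G by (rule normal)
  interpret Q: group "G Mod M" by (rule M.factorgroup_is_group)
  interpret q: group_hom G "G Mod M" "\<lambda>x. M #> x"
    using M.r_coset_hom_Mod by unfold_locales
  interpret \<theta>: group_hom G G \<theta> using \<theta>(1) by unfold_locales
  have Q_carrier: "carrier (G Mod M) = (\<lambda>x. M #> x) ` carrier G"
    by (simp add: carrier_FactGroup)
  have q_one: "M #> x = \<one>\<^bsub>G Mod M\<^esub>" if "x \<in> M" for x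
    using that M.subset by (simp add: coset_join2 M.subgroup_axioms subset_iff)
  have comm: "(M #> a) \<otimes>\<^bsub>G Mod M\<^esub> (M #> b) = (M #> b) \<otimes>\<^bsub>G Mod M\<^esub> (M #> a)"
    if ab: "a \<in> carrier G" "b \<in> carrier G" for a b
  proof -
    have "a \<otimes> b \<otimes> inv (b \<otimes> a) \<in> M" using MA ab by blast
    then have "M #> (a \<otimes> b \<otimes> inv (b \<otimes> a) \<otimes> (b \<otimes> a)) = M #> (b \<otimes> a)"
      using ab q.hom_mult[of "a \<otimes> b \<otimes> inv (b \<otimes> a)" "b \<otimes> a"] q_one
      by (simp del: mult_FactGroup one_FactGroup)
    then have "M #> (a \<otimes> b) = M #> (b \<otimes> a)" using ab by (simp add: m_assoc)
    then show ?thesis using ab by (metis q.hom_mult)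
  qed
  have Q_comm: "comm_group (G Mod M)"
  proof (rule Q.group_comm_groupI)
    fix x y assume "x \<in> carrier (G Mod M)" "y \<in> carrier (G Mod M)"
    then show "x \<otimes>\<^bsub>G Mod M\<^esub> y = y \<otimes>\<^bsub>G Mod M\<^esub> x"
      unfolding Q_carrier using comm by blast
  qed
  have exponent: "Y [^]\<^bsub>G Mod M\<^esub> p = \<one>\<^bsub>G Mod M\<^esub>" if Y: "Y \<in> carrier (G Mod M)" for Y
  proof -
    obtain a where a: "a \<in> carrier G" "Y = M #> a" using Y unfolding Q_carrier by blast
    have "a [^] p \<in> M" using MA a(1) by blast
    then show ?thesis unfolding a(2) q.hom_nat_pow[OF a(1), symmetric] by (rule q_one)
  qed
  have "card (rcosets M) dvd p ^ n"
    using lagrange[OF M.subgroup_axioms] order by (metis dvd_triv_left)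
  then obtain m where m: "order (G Mod M) = p ^ m"
    using p(1) by (auto simp: order_def FactGroup_def divides_primepow_nat)
  have \<theta>M: "\<theta> x \<in> M" if "x \<in> M" for x
    using \<theta>.commutator_power_subgroup_image that unfolding M_def by blast
  have hom\<theta>: "(\<lambda>x. M #> \<theta> x) \<in> hom G (G Mod M)"
    using Group.hom_compose[OF \<theta>(1) q.homh] by (simp add: o_def)
  \<comment> \<open>Well-definedness of the induced map: \<open>\<theta>\<close> sends
    \<open>M\<close> into itself.\<close>
  have const: "M #> \<theta> x = M #> \<theta> y"
    if xy: "x \<in> carrier G" "y \<in> carrier G" "M #> x = M #> y" for x y
  proof -
    have "x \<in> M #> y" using xy rcos_self[OF xy(1) M.subgroup_axioms] by simp
    then obtain h where h: "h \<in> M" "x = h \<otimes> y" by (auto simp: r_coset_def)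
    then have hG: "h \<in> carrier G" using M.subset by blast
    have "M #> \<theta> x = M #> (\<theta> h \<otimes> \<theta> y)"
      unfolding h(2) \<theta>.hom_mult[OF hG xy(2)] ..
    also have "\<dots> = (M #> \<theta> h) \<otimes>\<^bsub>G Mod M\<^esub> (M #> \<theta> y)"
      using hG xy(2) by (intro q.hom_mult \<theta>.hom_closed)
    also have "\<dots> = M #> \<theta> y"
      unfolding q_one[OF \<theta>M[OF h(1)]] using xy(2) by (intro Q.l_one q.hom_closed \<theta>.hom_closed)
    finally show ?thesis .
  qed
  obtain \<theta>' where \<theta>': "\<theta>' \<in> hom (G Mod M) (G Mod M)"
    and \<theta>'_eq: "\<And>x. x \<in> carrier G \<Longrightarrow> \<theta>' (M #> x) = M #> \<theta> x"
    using FactGroup_universal[OF hom\<theta> normal const] by blast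
  have "\<exists>k \<in> carrier (G Mod M). \<forall>y \<in> carrier (G Mod M). \<exists>j::nat. y = k [^]\<^bsub>G Mod M\<^esub> j"
  proof (rule comm_group.elementary_abelian_affine_cycle_imp_cyclic[OF Q_comm p m exponent \<theta>'])
    have "\<theta>' ` carrier (G Mod M) = (\<lambda>x. M #> x) ` (\<theta> ` carrier G)"
      unfolding Q_carrier image_image by (intro image_cong) (auto simp: \<theta>'_eq)
    then show "\<theta>' ` carrier (G Mod M) = carrier (G Mod M)" by (simp add: \<theta>(2) Q_carrier)
    show "M #> g \<in> carrier (G Mod M)" using g by simp
    show "M #> c 0 = \<one>\<^bsub>G Mod M\<^esub>" using c(1) by (metis q.hom_one)
    show "M #> c (Suc k) = \<theta>' (M #> c k) \<otimes>\<^bsub>G Mod M\<^esub> (M #> g)" for k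
    proof -
      have "c k \<in> carrier G" using c(3) by blast
      then show ?thesis using c(2) g by (simp add: \<theta>'_eq q.hom_mult del: mult_FactGroup)
    qed
    show "range (\<lambda>k. M #> c k) = carrier (G Mod M)"
      unfolding Q_carrier c(3)[symmetric] image_image ..
  qed
  then obtain x where x: "x \<in> carrier G"
    and gen: "\<And>y. y \<in> carrier G \<Longrightarrow> \<exists>j::nat. M #> y = (M #> x) [^]\<^bsub>G Mod M\<^esub> j"
    unfolding Q_carrier by blast
  have "\<exists>j::nat. y \<in> commutator_power_subgroup p #> x [^] j" if y: "y \<in> carrier G" for y
  proof -
    obtain j :: nat where "M #> y = (M #> x) [^]\<^bsub>G Mod M\<^esub> j" using gen[OF y] ..
    then have "M #> y = M #> x [^] j" using x by (simp add: q.hom_nat_pow)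
    then show ?thesis using rcos_self[OF y M.subgroup_axioms] unfolding M_def by auto
  qed
  then show ?thesis
    using generated_mod_commutator_power_subgroup[OF p(1) order x] x by blast
qed

section \<open>Regular subgroups normalized by a transitive action\<close>

lemma carrier_BijGroup: "carrier (BijGroup S) = Bij S"
  by (simp add: BijGroup_def)

lemma BijGroup_mult_apply:
  "f \<in> Bij S \<Longrightarrow> g \<in> Bij S \<Longrightarrow> x \<in> S \<Longrightarrow> (f \<otimes>\<^bsub>BijGroup S\<^esub> g) x = f (g x)"
  by (simp add: BijGroup_def compose_def)

text \<open>Evaluation at \<open>f x\<close> removes the inverse of \<open>f\<close>. In this form
  conjugation by \<open>f\<close> becomes a statement about points.\<close>

lemma BijGroup_conj_apply:
  assumes "f \<in> Bij S" "h \<in> Bij S" "x \<in> S"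
  shows "conj_by (BijGroup S) f h (f x) = f (h x)"
proof -
  interpret B: group "BijGroup S" by (rule group_BijGroup)
  note carrier = assms(1,2)[folded carrier_BijGroup]
  have "conj_by (BijGroup S) f h (f x) =
      (f \<otimes>\<^bsub>BijGroup S\<^esub> h \<otimes>\<^bsub>BijGroup S\<^esub> inv\<^bsub>BijGroup S\<^esub> f \<otimes>\<^bsub>BijGroup S\<^esub> f) x"
    using carrier assms(3)
    by (intro BijGroup_mult_apply[symmetric]) (simp_all flip: carrier_BijGroup)
  also have "\<dots> = (f \<otimes>\<^bsub>BijGroup S\<^esub> h) x"
    using carrier by (simp add: B.m_assoc)
  finally show ?thesis using assms by (simp add: BijGroup_mult_apply)
qed

lemma (in group) conjugation_hom:
  assumes "a \<in> carrier G"
  shows "(\<lambda>x. a \<otimes> x \<otimes> inv a) \<in> hom G G"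
proof (rule homI)
  have "inv a \<otimes> (a \<otimes> z) = z" if "z \<in> carrier G" for z
    using assms that by (simp flip: m_assoc)
  then show "a \<otimes> (x \<otimes> y) \<otimes> inv a = a \<otimes> x \<otimes> inv a \<otimes> (a \<otimes> y \<otimes> inv a)"
    if "x \<in> carrier G" "y \<in> carrier G" for x y
    using assms that by (simp add: m_assoc)
qed (use assms in simp)

lemma regular_subgroup_subset: "regular_subgroup S N \<Longrightarrow> N \<subseteq> Bij S"
  using subgroup.subset[of N "BijGroup S"] by (simp add: regular_subgroup_def carrier_BijGroup)

lemma regular_subgroup_eqI:
  assumes "regular_subgroup S N" "f \<in> N" "g \<in> N" "x \<in> S" "f x = g x"
  shows "f = g"
proof -
  have "N \<subseteq> Bij S" using assms(1) by (rule regular_subgroup_subset)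
  then have "f x \<in> S" using assms(2,4) Bij_imp_funcset by blast
  then show ?thesis using assms unfolding regular_subgroup_def by metis
qed

lemma regular_subgroup_bij_betw:
  assumes "regular_subgroup S N" "x \<in> S"
  shows "bij_betw (\<lambda>f. f x) N S"
proof (rule bij_betw_imageI)
  show "inj_on (\<lambda>f. f x) N"
    using regular_subgroup_eqI[OF assms(1) _ _ assms(2)] by (intro inj_onI)
  have "N \<subseteq> Bij S" using assms(1) by (rule regular_subgroup_subset)
  then have "f x \<in> S" if "f \<in> N" for f
    using that assms(2) Bij_imp_funcset by blast
  moreover have "\<exists>f \<in> N. f x = y" if "y \<in> S" for y
    using assms that unfolding regular_subgroup_def by metis
  ultimately show "(\<lambda>f. f x) ` N = S" by blast
qed

text \<open>The powers of a generator \<open>\<tau>\<close>, applied to \<open>x0\<close>, identify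
  \<open>E\<close> with the integers modulo \<open>p ^ n\<close>. A permutation that normalizes
  \<open>N\<close> is affine in this coordinate, so the results on affine maps apply to the image of
  \<open>G\<close>.\<close>

lemma (in transitive_action) cyclic_regular_subgroup_imp_cycle:
  assumes p: "Factorial_Ring.prime p" "odd p" and n: "n \<noteq> 0"
    and N: "regular_subgroup E N"
    and normalized: "\<And>g \<eta>. g \<in> carrier G \<Longrightarrow> \<eta> \<in> N \<Longrightarrow> conj_by (BijGroup E) (\<phi> g) \<eta> \<in> N"
    and cyclic: "cyclic_group ((BijGroup E)\<lparr>carrier := N\<rparr>)" and card: "card N = p ^ n"
    and x0: "x0 \<in> E"
  obtains g where "g \<in> carrier G" "\<And>y. y \<in> E \<Longrightarrow> \<exists>k. (\<phi> g ^^ k) x0 = y"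
proof -
  let ?B = "BijGroup E" and ?P = "(BijGroup E)\<lparr>carrier := N\<rparr>"
  interpret G: group G using group_hom group_hom.axioms(1) by blast
  interpret B: group ?B by (rule group_BijGroup)
  have sub: "subgroup N ?B" using N by (simp add: regular_subgroup_def)
  have NB: "N \<subseteq> Bij E" using N by (rule regular_subgroup_subset)
  interpret P: group ?P using sub by (rule B.subgroup_imp_group)
  obtain \<tau> where \<tau>: "\<tau> \<in> N" "subgroup_generated ?P {\<tau>} = ?P"
    using cyclic unfolding cyclic_group_def by auto
  have \<tau>B: "\<tau> \<in> carrier ?B" using \<tau>(1) NB by (auto simp: carrier_BijGroup)
  have ord: "P.ord \<tau> = p ^ n"
    using P.cyclic_order_is_ord[of \<tau>] \<tau> card by (simp add: order_def)
  have pow_P: "\<tau> [^]\<^bsub>?P\<^esub> (i::int) = \<tau> [^]\<^bsub>?B\<^esub> i" for i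
    using B.int_pow_consistent[OF sub \<tau>(1)] by simp
  have pow_N: "\<tau> [^]\<^bsub>?B\<^esub> (i::int) \<in> N" for i
    using B.subgroup_int_pow_closed[OF sub \<tau>(1)] .
  have pow_B: "\<tau> [^]\<^bsub>?B\<^esub> (i::int) \<in> Bij E" for i using pow_N NB by blast
  have pow_E: "(\<tau> [^]\<^bsub>?B\<^esub> (i::int)) x \<in> E" if "x \<in> E" for i x
    using pow_B Bij_imp_funcset that by blast
  have all_pow: "\<exists>i::int. \<eta> = \<tau> [^]\<^bsub>?B\<^esub> i" if \<eta>: "\<eta> \<in> N" for \<eta>
  proof -
    have "\<eta> \<in> carrier (subgroup_generated ?P {\<tau>})" unfolding \<tau>(2) using \<eta> by simp
    then show ?thesis
      using \<tau>(1) by (auto simp: P.carrier_subgroup_generated_by_singleton pow_P)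
  qed
  define e where "e i = (\<tau> [^]\<^bsub>?B\<^esub> (i::int)) x0" for i
  have e_eq: "e i = e j \<longleftrightarrow> [i = j] (mod int p ^ n)" for i j
  proof -
    have "e i = e j \<longleftrightarrow> \<tau> [^]\<^bsub>?B\<^esub> i = \<tau> [^]\<^bsub>?B\<^esub> j"
      unfolding e_def using regular_subgroup_eqI[OF N pow_N pow_N x0] by metis
    also have "\<dots> \<longleftrightarrow> int (p ^ n) dvd j - i"
      unfolding pow_P[symmetric] using P.int_pow_eq[of \<tau> i j] \<tau>(1) ord by simp
    also have "\<dots> \<longleftrightarrow> [i = j] (mod int p ^ n)"
      by (metis cong_iff_dvd_diff cong_sym_eq of_nat_power)
    finally show ?thesis .
  qed
  have e_onto: "\<exists>i. e i = y" if y: "y \<in> E" for y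
  proof -
    have "y \<in> (\<lambda>f. f x0) ` N"
      using regular_subgroup_bij_betw[OF N x0] y by (simp add: bij_betw_def)
    then show ?thesis using all_pow unfolding e_def by blast
  qed
  have e_E: "e i \<in> E" for i unfolding e_def using pow_E x0 .
  have affine: "\<exists>a b. \<forall>i. f (e i) = e (a * i + b)" if f: "f \<in> \<phi> ` carrier G" for f
  proof -
    obtain g where g: "g \<in> carrier G" "f = \<phi> g" using f by blast
    have fB: "f \<in> Bij E" using bij_prop0 g by simp
    \<comment> \<open>The linear part \<open>a\<close> is the exponent by which conjugation acts on
      \<open>\<tau>\<close>; the constant part \<open>b\<close> will be the coordinate of
      \<open>f x0\<close>.\<close>
    obtain a where a: "conj_by ?B f \<tau> = \<tau> [^]\<^bsub>?B\<^esub> (a::int)"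
      using all_pow normalized[OF g(1) \<tau>(1)] g(2) by blast
    have "f x0 \<in> E" using fB x0 Bij_imp_funcset by blast
    then obtain b where b: "f x0 = e b" using e_onto by metis
    have "f (e i) = e (a * i + b)" for i
    proof -
      have "f (e i) = conj_by ?B f (\<tau> [^]\<^bsub>?B\<^esub> i) (f x0)"
        unfolding e_def using BijGroup_conj_apply[OF fB pow_B x0] by simp
      also have "conj_by ?B f (\<tau> [^]\<^bsub>?B\<^esub> i) = conj_by ?B f \<tau> [^]\<^bsub>?B\<^esub> i"
        using hom_int_pow[OF B.conjugation_hom \<tau>B group_BijGroup group_BijGroup] fB by (simp add: carrier_BijGroup)
      also have "\<dots> = \<tau> [^]\<^bsub>?B\<^esub> (a * i)"
        unfolding a using \<tau>B by (rule B.int_pow_pow)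
      also have "\<dots> (f x0) = (\<tau> [^]\<^bsub>?B\<^esub> (a * i) \<otimes>\<^bsub>?B\<^esub> \<tau> [^]\<^bsub>?B\<^esub> b) x0"
        unfolding b e_def using BijGroup_mult_apply[OF pow_B pow_B x0] by simp
      also have "\<dots> = e (a * i + b)"
        unfolding e_def using B.int_pow_mult[OF \<tau>B] by simp
      finally show ?thesis .
    qed
    then show ?thesis by blast
  qed
  obtain f a b where f: "f \<in> \<phi> ` carrier G" "\<And>i. f (e i) = e (a * i + b)"
    "[a = 1] (mod int p)" "\<not> int p dvd b"
  proof (rule transitive_affine_obtains_unipotent[OF p(1) n, of e "\<phi> ` carrier G"])
    show "\<exists>h \<in> \<phi> ` carrier G. \<forall>i. h (e i) = f (g (e i))"
      if fg: "f \<in> \<phi> ` carrier G" "g \<in> \<phi> ` carrier G" for f g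
    proof -
      obtain u v where "u \<in> carrier G" "f = \<phi> u" "v \<in> carrier G" "g = \<phi> v" using fg by blast
      then show ?thesis using composition_rule[OF e_E] by (intro bexI[of _ "\<phi> (u \<otimes> v)"]) auto
    qed
    show "\<exists>g \<in> \<phi> ` carrier G. \<forall>i. f (g (e i)) = e i" if f: "f \<in> \<phi> ` carrier G" for f
    proof -
      obtain u where u: "u \<in> carrier G" "f = \<phi> u" using f by blast
      have "f (\<phi> (inv u) (e i)) = e i" for i
        using composition_rule[OF e_E u(1) G.inv_closed[OF u(1)]] u e_E
        by (simp flip: id_eq_one)
      then show ?thesis using u(1) by (intro bexI[of _ "\<phi> (inv u)"]) auto
    qed
    show "\<exists>f \<in> \<phi> ` carrier G. f (e i) = e j" for i j
      using unique_orbit[OF e_E e_E] by blast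
  qed (use e_eq affine in auto)
  obtain g where g: "g \<in> carrier G" "f = \<phi> g" using f(1) by blast
  have e0: "e 0 = x0" using x0 by (simp add: e_def BijGroup_def)
  have "\<exists>k. (\<phi> g ^^ k) x0 = y" if y: "y \<in> E" for y
    using unipotent_affine_orbit[OF p e_eq f(2-4)] e_onto[OF y] g(2) e0 by metis
  then show thesis using that g(1) by blast
qed

text \<open>Regularity carries the cycle of \<open>f\<close> from \<open>S\<close> over to
  \<open>N\<close>. Let \<open>\<theta>\<close> be conjugation by \<open>f\<close>, let
  \<open>g\<close> in \<open>N\<close> agree with \<open>f\<close> at \<open>x0\<close>, and let
  \<open>c k\<close> take \<open>x0\<close> to \<open>(f ^^ k) x0\<close>. Then
  \<open>f (c k x0) = \<theta> (c k) (f x0) = \<theta> (c k) (g x0)\<close>, so \<open>c\<close> is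
  an affine cycle on \<open>N\<close>.\<close>

lemma cycle_normalizing_regular_subgroup_imp_cyclic:
  assumes p: "Factorial_Ring.prime p" "odd p" and N: "regular_subgroup S N" and card: "card N = p ^ n"
    and f: "f \<in> Bij S" "\<And>\<eta>. \<eta> \<in> N \<Longrightarrow> conj_by (BijGroup S) f \<eta> \<in> N"
    and x0: "x0 \<in> S" and cycle: "\<And>y. y \<in> S \<Longrightarrow> \<exists>k. (f ^^ k) x0 = y"
  shows "cyclic_group ((BijGroup S)\<lparr>carrier := N\<rparr>)"
proof -
  let ?B = "BijGroup S" and ?P = "(BijGroup S)\<lparr>carrier := N\<rparr>"
  interpret B: group ?B by (rule group_BijGroup)
  have sub: "subgroup N ?B" using N by (simp add: regular_subgroup_def)
  have NB: "N \<subseteq> Bij S" using N by (rule regular_subgroup_subset)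
  interpret P: group ?P using sub by (rule B.subgroup_imp_group)
  have fin: "finite N" using card p(1) by (metis card.infinite power_not_zero not_prime_0)
  define \<theta> where "\<theta> \<eta> = conj_by ?B f \<eta>" for \<eta>
  have \<theta>_apply: "\<theta> \<eta> (f x) = f (\<eta> x)" if "\<eta> \<in> N" "x \<in> S" for \<eta> x
    unfolding \<theta>_def using BijGroup_conj_apply[OF f(1)] that NB by blast
  have fS: "f x \<in> S" if "x \<in> S" for x using f(1) that Bij_imp_funcset by blast
  have NS: "\<eta> x \<in> S" if "\<eta> \<in> N" "x \<in> S" for \<eta> x using NB that Bij_imp_funcset by blast
  have \<theta>_hom: "\<theta> \<in> hom ?P ?P"
  proof (rule homI)
    show "\<theta> \<eta> \<in> carrier ?P" if "\<eta> \<in> carrier ?P" for \<eta> using f(2) that by (simp add: \<theta>_def)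
    show "\<theta> (\<eta> \<otimes>\<^bsub>?P\<^esub> \<eta>') = \<theta> \<eta> \<otimes>\<^bsub>?P\<^esub> \<theta> \<eta>'" if "\<eta> \<in> carrier ?P" "\<eta>' \<in> carrier ?P" for \<eta> \<eta>'
      using hom_mult[OF B.conjugation_hom, of f \<eta> \<eta>'] that NB f(1) by (auto simp: \<theta>_def carrier_BijGroup)
  qed
  have \<theta>_onto: "\<theta> ` N = N"
  proof (rule endo_inj_surj[OF fin])
    show "\<theta> ` N \<subseteq> N" using f(2) by (auto simp: \<theta>_def)
    show "inj_on \<theta> N"
    proof (rule inj_onI)
      fix \<eta> \<eta>' assume \<eta>: "\<eta> \<in> N" "\<eta>' \<in> N" "\<theta> \<eta> = \<theta> \<eta>'"
      then have "f (\<eta> x0) = f (\<eta>' x0)" using \<theta>_apply x0 by metis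
      then have "\<eta> x0 = \<eta>' x0"
        using f(1) NS[OF \<eta>(1) x0] NS[OF \<eta>(2) x0] by (auto simp: Bij_def bij_betw_def inj_on_def)
      then show "\<eta> = \<eta>'" using regular_subgroup_eqI[OF N \<eta>(1,2) x0] by simp
    qed
  qed
  obtain g where g: "g \<in> N" "g x0 = f x0"
    using N x0 fS[OF x0] unfolding regular_subgroup_def by blast
  define c where "c = rec_nat \<one>\<^bsub>?P\<^esub> (\<lambda>_ \<eta>. \<theta> \<eta> \<otimes>\<^bsub>?P\<^esub> g)"
  have c: "c 0 = \<one>\<^bsub>?P\<^esub>" "\<And>k. c (Suc k) = \<theta> (c k) \<otimes>\<^bsub>?P\<^esub> g" by (simp_all add: c_def)
  have cN: "c k \<in> N" for k
  proof (induction k)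
    case (Suc k)
    then show ?case using c(2) \<theta>_onto g(1) subgroup.m_closed[OF sub] by auto
  qed (use c(1) subgroup.one_closed[OF sub] in simp)
  have c_apply: "c k x0 = (f ^^ k) x0" for k
  proof (induction k)
    case 0
    show ?case using x0 c(1) by (simp add: BijGroup_def)
  next
    case (Suc k)
    have "\<theta> (c k) \<in> Bij S" "g \<in> Bij S" using \<theta>_onto cN[of k] g(1) NB by blast+
    then have "c (Suc k) x0 = \<theta> (c k) (g x0)"
      using c(2) x0 by (simp add: BijGroup_mult_apply)
    then show ?case using g(2) \<theta>_apply[OF cN x0] Suc by simp
  qed
  have "range c = carrier ?P"
  proof
    show "carrier ?P \<subseteq> range c"
    proof
      fix \<eta> assume "\<eta> \<in> carrier ?P"
      then have \<eta>: "\<eta> \<in> N" by simp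
      obtain k where "(f ^^ k) x0 = \<eta> x0" using cycle NS[OF \<eta> x0] by blast
      then have "\<eta> = c k" using regular_subgroup_eqI[OF N \<eta> cN x0] c_apply by simp
      then show "\<eta> \<in> range c" by blast
    qed
  qed (use cN in auto)
  then obtain x where x: "x \<in> carrier ?P" "generate ?P {x} = carrier ?P"
    using P.prime_power_group_affine_cycle_imp_cyclic[OF p _ \<theta>_hom _ _ c, of n] card \<theta>_onto g(1)
    by (auto simp: order_def)
  then have "subgroup_generated ?P {x} = ?P"
    by (simp add: subgroup_generated_def)
  then show ?thesis
    using x(1) unfolding cyclic_group_def by blast
qed

text \<open>The cycle obtained from \<open>N\<close> lies in the image of \<open>G\<close> and so
  normalizes \<open>N'\<close> too. Both subgroups are in bijection with \<open>E\<close>, which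
  gives \<open>N'\<close> the order \<open>p ^ n\<close>.\<close>

lemma (in transitive_action) regular_subgroup_cyclic:
  assumes p: "Factorial_Ring.prime p" "odd p" and n: "n \<noteq> 0"
    and N: "regular_subgroup E N" "regular_subgroup E N'"
    and normalized: "\<And>g \<eta>. g \<in> carrier G \<Longrightarrow> \<eta> \<in> N \<Longrightarrow> conj_by (BijGroup E) (\<phi> g) \<eta> \<in> N"
      "\<And>g \<eta>. g \<in> carrier G \<Longrightarrow> \<eta> \<in> N' \<Longrightarrow> conj_by (BijGroup E) (\<phi> g) \<eta> \<in> N'"
    and cyclic: "cyclic_group ((BijGroup E)\<lparr>carrier := N\<rparr>)" and card: "card N = p ^ n"
  shows "cyclic_group ((BijGroup E)\<lparr>carrier := N'\<rparr>)"
proof -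
  have "E \<noteq> {}"
  proof
    assume "E = {}"
    \<comment> \<open>Elements of \<open>Bij\<close> are extensional, so on the empty set the
      everywhere undefined map is the only one, whereas \<open>p ^ n\<close> exceeds
      \<open>1\<close>.\<close>
    then have "N \<subseteq> {\<lambda>_. undefined}"
      using regular_subgroup_subset[OF N(1)] by (auto simp: Bij_def)
    then have "card N \<le> 1" using card_mono[of "{\<lambda>_. undefined}" N] by simp
    moreover have "1 < p ^ n" using p(1) n by (intro one_less_power prime_gt_1_nat) auto
    ultimately show False using card by simp
  qed
  then obtain x0 where x0: "x0 \<in> E" by blast
  obtain g where g: "g \<in> carrier G" "\<And>y. y \<in> E \<Longrightarrow> \<exists>k. (\<phi> g ^^ k) x0 = y"
    using cyclic_regular_subgroup_imp_cycle[OF p n N(1) normalized(1) cyclic card x0] by blast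
  have "card N' = p ^ n"
    using bij_betw_same_card[OF regular_subgroup_bij_betw[OF N(1) x0]]
      bij_betw_same_card[OF regular_subgroup_bij_betw[OF N(2) x0]] card by simp
  then show ?thesis
    using cycle_normalizing_regular_subgroup_imp_cyclic[OF p N(2) _ bij_prop0[OF g(1)] normalized(2)[OF g(1)] x0 g(2)]
    by blast
qed

section \<open>The Galois group as a transitive permutation group\<close>

lemma subgroup_Gal:
  assumes "ring M" and "F \<subseteq> carrier M"
  shows "subgroup (carrier (Gal M F)) (BijGroup (carrier M))"
proof -
  interpret M: ring M by fact
  interpret B: group "BijGroup (carrier M)" by (rule group_BijGroup)
  have mem: "\<sigma> \<in> carrier (Gal M F) \<longleftrightarrow>
    \<sigma> \<in> ring_iso M M \<and> \<sigma> \<in> Bij (carrier M) \<and> (\<forall>x \<in> F. \<sigma> x = x)" for \<sigma>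
    by (auto simp: Gal_def Bij_def ring_iso_def)
  \<comment> \<open>Inverses and composites are first seen to be isomorphisms as plain functions;
    this fact passes to their restrictions to the carrier.\<close>
  have iso: "\<tau> \<in> ring_iso M M" if "\<sigma> \<in> ring_iso M M" "\<And>x. x \<in> carrier M \<Longrightarrow> \<sigma> x = \<tau> x" for \<sigma> \<tau>
    using that M.ring_axioms by (metis ring.ring_iso_restrict)
  show ?thesis
  proof (rule B.subgroupI)
    show "carrier (Gal M F) \<subseteq> carrier (BijGroup (carrier M))" using mem by (auto simp: carrier_BijGroup)
    have "(\<lambda>x \<in> carrier M. x) \<in> ring_iso M M"
      by (rule iso[of id]) (auto simp: ring_iso_set_refl)
    then have "(\<lambda>x \<in> carrier M. x) \<in> carrier (Gal M F)"
      using assms(2) by (auto simp: mem id_Bij)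
    then show "carrier (Gal M F) \<noteq> {}" by blast
  next
    fix \<sigma> assume \<sigma>: "\<sigma> \<in> carrier (Gal M F)"
    then have inv: "inv\<^bsub>BijGroup (carrier M)\<^esub> \<sigma> = restrict (inv_into (carrier M) \<sigma>) (carrier M)"
      by (simp add: mem inv_BijGroup)
    have "restrict (inv_into (carrier M) \<sigma>) (carrier M) \<in> ring_iso M M"
    proof (rule iso[of "inv_into (carrier M) \<sigma>"])
      show "inv_into (carrier M) \<sigma> \<in> ring_iso M M"
        using \<sigma> assms(1) unfolding mem by (blast intro: ring_iso_set_sym)
    qed simp
    moreover have "inv_into (carrier M) \<sigma> x = x" if x: "x \<in> F" for x
    proof -
      have "inj_on \<sigma> (carrier M)" "\<sigma> x = x" using \<sigma> x by (simp_all add: mem Bij_def bij_betw_def)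
      then show ?thesis using inv_into_f_f[of \<sigma> "carrier M" x] x assms(2) by auto
    qed
    ultimately show "inv\<^bsub>BijGroup (carrier M)\<^esub> \<sigma> \<in> carrier (Gal M F)"
      unfolding inv using \<sigma> assms(2) by (auto simp: mem restrict_inv_into_Bij)
  next
    fix \<sigma> \<tau> assume \<sigma>\<tau>: "\<sigma> \<in> carrier (Gal M F)" "\<tau> \<in> carrier (Gal M F)"
    then have mult: "\<sigma> \<otimes>\<^bsub>BijGroup (carrier M)\<^esub> \<tau> = compose (carrier M) \<sigma> \<tau>"
      by (simp add: mem BijGroup_def)
    have "compose (carrier M) \<sigma> \<tau> \<in> ring_iso M M"
    proof (rule iso[of "\<sigma> \<circ> \<tau>"])
      show "\<sigma> \<circ> \<tau> \<in> ring_iso M M"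
        using \<sigma>\<tau> unfolding mem by (blast intro: ring_iso_set_trans)
    qed (simp add: compose_def)
    then show "\<sigma> \<otimes>\<^bsub>BijGroup (carrier M)\<^esub> \<tau> \<in> carrier (Gal M F)"
      unfolding mult mem using \<sigma>\<tau> assms(2) compose_Bij[of \<sigma> "carrier M" \<tau>]
      by (auto simp: mem compose_eq subset_iff)
  qed
qed

text \<open>As \<open>K \<subseteq> L\<close>, the group \<open>Gal M L\<close> is a subgroup of
  \<open>Gal M K\<close>, and the general action on left cosets applies.\<close>

lemma left_translation_transitive_action:
  assumes "ring M" and "K \<subseteq> L" and "L \<subseteq> carrier M"
  shows "transitive_action (Gal M K) (coset_space M K L) (left_translation M K L)"
proof -
  interpret B: group "BijGroup (carrier M)" by (rule group_BijGroup)
  have K: "subgroup (carrier (Gal M K)) (BijGroup (carrier M))"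
    and L: "subgroup (carrier (Gal M L)) (BijGroup (carrier M))"
    using assms by (auto intro: subgroup_Gal)
  have Gal_K: "Gal M K = (BijGroup (carrier M))\<lparr>carrier := carrier (Gal M K)\<rparr>"
    by (simp add: Gal_def)
  interpret G: group "Gal M K" using B.subgroup_imp_group[OF K] Gal_K by simp
  have "carrier (Gal M L) \<subseteq> carrier (Gal M K)" using assms(2) by (auto simp: Gal_def)
  then have "subgroup (carrier (Gal M L)) (Gal M K)"
    using B.subgroup_incl[OF L K] Gal_K by simp
  from G.left_coset_action[OF this] show ?thesis
    unfolding coset_space_def[symmetric] left_translation_def .
qed

lemma cyclic_integer_mod_group: "cyclic_group (integer_mod_group n)"
proof (cases "n = 1")
  \<comment> \<open>For \<open>n = 1\<close> the carrier is \<open>{0}\<close>, so \<open>1\<close>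
    is not an element. Otherwise \<open>1\<close> generates, also for \<open>n = 0\<close>, where
    the group is that of all integers.\<close>
  case True
  then show ?thesis by (simp add: trivial_imp_cyclic_group trivial_integer_mod_group)
next
  case False
  interpret group "integer_mod_group n" by simp
  have carrier: "carrier (integer_mod_group n) = range (\<lambda>i::int. 1 [^]\<^bsub>integer_mod_group n\<^esub> i)"
  proof
    show "carrier (integer_mod_group n) \<subseteq> range (\<lambda>i::int. 1 [^]\<^bsub>integer_mod_group n\<^esub> i)"
    proof
      fix x assume "x \<in> carrier (integer_mod_group n)"
      then have "x = 1 [^]\<^bsub>integer_mod_group n\<^esub> x"
        by (auto simp: int_pow_integer_mod_group carrier_integer_mod_group split: if_splits)
      then show "x \<in> range (\<lambda>i::int. 1 [^]\<^bsub>integer_mod_group n\<^esub> i)" by (rule range_eqI)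
    qed
  qed (use False in auto)
  have "1 \<in> carrier (integer_mod_group n)" using False by simp
  with carrier show ?thesis unfolding cyclic_group by blast
qed

theorem proposition4:
  fixes M :: "'m ring" and K L :: "'m set" and p n :: nat
  assumes "Factorial_Ring.prime p" and "odd p" and "n \<ge> 2"
    and "field M" and "subfield K M" and "subfield L M" and "K \<subseteq> L"
    and "normal_closure M K L"
    and "separable_extension M K L"
    and "ring.dimension M (p ^ n) K L"
    and "\<exists>(H :: ('m, 'h) hopf) \<mu>.
           hopf_galois_structure M K L H \<mu> \<and>
           hopf_galois_type M K L H \<mu> (integer_mod_group (p ^ n))"
  shows "\<not> (\<exists>(H :: ('m, 'i) hopf) \<mu> (T :: 't monoid).
           hopf_galois_structure M K L H \<mu> \<and>
           hopf_galois_type M K L H \<mu> T \<and>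
           group T \<and> order T = p ^ n \<and> \<not> cyclic_group T)"
proof (rule notI, elim exE conjE)
  fix H :: "('m, 'i) hopf" and \<mu> and T :: "'t monoid"
  assume type: "hopf_galois_type M K L H \<mu> T" and T: "group T" "\<not> cyclic_group T"
  let ?S = "coset_space M K L"
  have "ring M" using assms(4) by (simp add: field.is_ring)
  moreover have "L \<subseteq> carrier M" using assms(6) subfieldE(3) by blast
  ultimately interpret transitive_action "Gal M K" ?S "left_translation M K L"
    using assms(7) by (intro left_translation_transitive_action)
  have regular_group: "group ((BijGroup ?S)\<lparr>carrier := N\<rparr>)" if "regular_subgroup ?S N" for N
    using that unfolding regular_subgroup_def
    by (blast intro: group.subgroup_imp_group[OF group_BijGroup])
  \<comment> \<open>Unfolding the notion of type produces the regular subgroup, its normalization by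
    the Galois group and its isomorphism class at once; the same is done for
    \<open>T\<close>.\<close>
  obtain N where N: "regular_subgroup ?S N" "normalized_by_Gal M K L N"
    and N_iso: "(BijGroup ?S)\<lparr>carrier := N\<rparr> \<cong> integer_mod_group (p ^ n)"
    using assms(11) by (auto simp: hopf_galois_type_def corresponding_subgroup_def)
  obtain N' where N': "regular_subgroup ?S N'" "normalized_by_Gal M K L N'"
    and N'_iso: "(BijGroup ?S)\<lparr>carrier := N'\<rparr> \<cong> T"
    using type by (auto simp: hopf_galois_type_def corresponding_subgroup_def)
  have cyclic: "cyclic_group ((BijGroup ?S)\<lparr>carrier := N\<rparr>)"
    using isomorphic_group_cyclicity[OF N_iso regular_group[OF N(1)]] cyclic_integer_mod_group by simp
  have "order ((BijGroup ?S)\<lparr>carrier := N\<rparr>) = order (integer_mod_group (p ^ n))"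
    using N_iso by (auto simp: is_iso_def intro: iso_same_order)
  then have card: "card N = p ^ n"
    using assms(1) by (auto simp: order_def carrier_integer_mod_group nat_power_eq)
  have "cyclic_group ((BijGroup ?S)\<lparr>carrier := N'\<rparr>)"
    using regular_subgroup_cyclic[OF assms(1,2) _ N(1) N'(1) _ _ cyclic card] N(2) N'(2) assms(3)
    by (simp add: normalized_by_Gal_def)
  then show False
    using isomorphic_group_cyclicity[OF N'_iso regular_group[OF N'(1)] T(1)] T(2) by simp
qed

end
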